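(* Let $s\in\mathbb{N}$, and let $c_s>0$ be a number such that $c_s/(n+|k|)^s\le\tilde e(n,k,s)$ for all $k\in\mathbb{Z}$ and $n\in\mathbb{N}$. Consider the absolute error criterion for the integration problem $I_k$ over the periodic space $\widetilde H^s$. (a) For $k=0$ and all $\varepsilon\in(0,1)$ we have $$c_s^{1/s}\left(\frac1\varepsilon\right)^{1/s}\le\tilde n^{\rm abs}(\varepsilon,0,s)\le\left\lceil\frac3{2\pi}\left(\frac{\sqrt2}{\varepsilon}\right)^{1/s}\right\rceil.$$ (b) For $k\in\mathbb{Z}$, $k\ne0$, and $\varepsilon\in[1/(2\pi|k|)^s,1)$ we have $\tilde n^{\rm abs}(\varepsilon,k,s)=0$, whereas for $\varepsilon\in(0,1/(2\pi|k|)^s)$ we have $$c_s^{1/s}\left(\frac1\varepsilon\right)^{1/s}-|k|\le\tilde n^{\rm abs}(\varepsilon,k,s)\le\left\lceil\frac3{2\pi}\left(\frac{\sqrt2}{\varepsilon}\right)^{1/s}\right\rceil-|k|.$$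
   Context: For $s\in\mathbb{N}=\{1,2,\dots\}$ let $H^s=\{f:[0,1]\to\mathbb{C} : f^{(s-1)}\text{ is absolutely continuous},\ f^{(s)}\in L_2([0,1])\}$ with inner product $$\langle f,g\rangle_s=\sum_{\ell=0}^{s-1}\int_0^1 f^{(\ell)}(x)\,dx\ \int_0^1\overline{g^{(\ell)}(x)}\,dx+\int_0^1 f^{(s)}(x)\,\overline{g^{(s)}(x)}\,dx$$ and norm $\|f\|_{H^s}=\langle f,f\rangle_s^{1/2}$. The periodic subspace is $\widetilde H^s=\{f\in H^s : f^{(\ell)}(0)=f^{(\ell)}(1)\text{ for }\ell=0,1,\dots,s-1\}$ with the same inner product. For $k\in\mathbb{Z}$, $I_k(f)=\int_0^1 f(x)\,e^{-2\pi i kx}\,dx$. Algorithms using $n$ values have the form $A_n(f)=\sum_{j=1}^n a_j f^{(\ell_j)}(x_j)$ with $a_j\in\mathbb{C}$, $\ell_j\in\{0,\dots,s-1\}$, $x_j\in[0,1]$; for $n=0$ the only algorithm is $A_0=0$. Set $\tilde e(A_n)=\sup\{|I_k(f)-A_n(f)| : f\in\widetilde H^s,\ \|f\|_{H^s}\le1\}$ and $\tilde e(n,k,s)=\inf_{A_n}\tilde e(A_n)$. A number $c_s>0$ depending only on $s$ with $c_s/(n+|k|)^s\le\tilde e(n,k,s)$ for all $k\in\mathbb{Z}$, $n\in\mathbb{N}$ is known to exist. The information complexity for the absolute error criterion is $\tilde n^{\rm abs}(\varepsilon,k,s)=\min\{n\in\{0,1,2,\dots\} : \tilde e(n,k,s)\le\varepsilon\}$.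 *)

theory Defs
  imports "HOL-Analysis.Analysis"
begin

text \<open>
  Functions \<open>f : [0,1] \<rightarrow> \<complex>\<close> are modelled as total functions \<open>real \<Rightarrow> complex\<close>; every notion below
  depends only on the values of \<open>f\<close> on \<open>{0..1}\<close>. In particular derivatives are taken within
  \<open>{0..1}\<close>, so they are one-sided at the two endpoints.
\<close>

abbreviation unit_leb :: "real measure" where
  "unit_leb \<equiv> lebesgue_on {0..1}"

primrec nth_deriv :: "nat \<Rightarrow> (real \<Rightarrow> complex) \<Rightarrow> real \<Rightarrow> complex" where
  "nth_deriv 0 f = f"
| "nth_deriv (Suc l) f = (\<lambda>x. vector_derivative (nth_deriv l f) (at x within {0..1}))"

text \<open>
  The usual \<open>\<epsilon>\<close>-\<open>\<delta>\<close> definition: \<open>\<D>\<close> ranges over the finite families of nonoverlapping compact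
  intervals \<open>K = {Inf K..Sup K}\<close> contained in \<open>S\<close>.
\<close>

definition absolutely_continuous_fun_on :: "real set \<Rightarrow> (real \<Rightarrow> complex) \<Rightarrow> bool" where
  "absolutely_continuous_fun_on S f \<longleftrightarrow>
     (\<forall>\<epsilon>>0. \<exists>\<delta>>0. \<forall>\<D>. \<D> division_of \<Union>\<D> \<and> \<Union>\<D> \<subseteq> S \<and> (\<Sum>K\<in>\<D>. Sup K - Inf K) < \<delta>
        \<longrightarrow> (\<Sum>K\<in>\<D>. norm (f (Sup K) - f (Inf K))) < \<epsilon>)"

definition square_integrable_on_unit :: "(real \<Rightarrow> complex) \<Rightarrow> bool" where
  "square_integrable_on_unit g \<longleftrightarrow>
     g \<in> borel_measurable unit_leb \<and> integrable unit_leb (\<lambda>x. (norm (g x))\<^sup>2)"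

text \<open>
  The derivative of order \<open>s\<close> is only defined almost everywhere. Its existence almost everywhere,
  which is part of the meaning of \<open>f\<^sup>(\<^sup>s\<^sup>) \<in> L\<^sub>2\<close> (and follows from absolute continuity of the derivative
  of order \<open>s - 1\<close> by Lebesgue's theorem), is stated explicitly because \<^const>\<open>vector_derivative\<close>
  is total, with unspecified values at points of non-differentiability.
\<close>

definition sobolev :: "nat \<Rightarrow> (real \<Rightarrow> complex) set" where
  "sobolev s = {f.
     (\<forall>l<s - 1. \<forall>x\<in>{0..1}. nth_deriv l f differentiable (at x within {0..1})) \<and>
     absolutely_continuous_fun_on {0..1} (nth_deriv (s - 1) f) \<and>
     (AE x in unit_leb. nth_deriv (s - 1) f differentiable (at x within {0..1})) \<and>
     square_integrable_on_unit (nth_deriv s f)}"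

definition sobolev_inner :: "nat \<Rightarrow> (real \<Rightarrow> complex) \<Rightarrow> (real \<Rightarrow> complex) \<Rightarrow> complex" where
  "sobolev_inner s f g =
     (\<Sum>l<s. (\<integral>x. nth_deriv l f x \<partial>unit_leb) * (\<integral>x. cnj (nth_deriv l g x) \<partial>unit_leb))
     + (\<integral>x. nth_deriv s f x * cnj (nth_deriv s g x) \<partial>unit_leb)"

definition sobolev_norm :: "nat \<Rightarrow> (real \<Rightarrow> complex) \<Rightarrow> real" where
  "sobolev_norm s f = sqrt (Re (sobolev_inner s f f))"

definition periodic_sobolev :: "nat \<Rightarrow> (real \<Rightarrow> complex) set" where
  "periodic_sobolev s = {f \<in> sobolev s. \<forall>l<s. nth_deriv l f 0 = nth_deriv l f 1}"

definition osc_integral :: "int \<Rightarrow> (real \<Rightarrow> complex) \<Rightarrow> complex" where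
  "osc_integral k f =
     (\<integral>x. f x * exp (- 2 * of_real pi * \<i> * of_int k * of_real x) \<partial>unit_leb)"

definition algorithms :: "nat \<Rightarrow> nat \<Rightarrow> ((real \<Rightarrow> complex) \<Rightarrow> complex) set" where
  "algorithms s n =
     {\<lambda>f. \<Sum>j<n. a j * nth_deriv (l j) f (x j) | (a :: nat \<Rightarrow> complex) (l :: nat \<Rightarrow> nat) (x :: nat \<Rightarrow> real).
        \<forall>j<n. l j < s \<and> x j \<in> {0..1}}"

text \<open>Errors are \<^typ>\<open>ennreal\<close>-valued so that the supremum is meaningful without a boundedness proof.\<close>

definition worst_case_error ::
  "int \<Rightarrow> nat \<Rightarrow> ((real \<Rightarrow> complex) \<Rightarrow> complex) \<Rightarrow> ennreal" where
  "worst_case_error k s A =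
     (SUP f\<in>{f \<in> periodic_sobolev s. sobolev_norm s f \<le> 1}. ennreal (norm (osc_integral k f - A f)))"

definition minimal_error :: "nat \<Rightarrow> int \<Rightarrow> nat \<Rightarrow> ennreal" where
  "minimal_error n k s = (INF A\<in>algorithms s n. worst_case_error k s A)"

definition info_complexity_abs :: "real \<Rightarrow> int \<Rightarrow> nat \<Rightarrow> nat" where
  "info_complexity_abs \<epsilon> k s = (LEAST n. minimal_error n k s \<le> ennreal \<epsilon>)"

end

theory Submission
  imports Defs
begin

text \<open>
  Both upper bounds come from a single algorithm, the rectangle rule with nodes \<open>j / n\<close> applied to
  \<open>f(x) exp(-2 \<pi> \<i> k x)\<close>. Once the Fourier series of a periodic \<open>H\<^sup>s\<close> function is known to converge to it at
  every point (\<open>Fourier_series_pointwise\<close>), the value of the rule is the sum of the Fourier coefficients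
  of \<open>f\<close> at all \<open>h \<equiv> k (mod n)\<close>. The term \<open>h = k\<close> is \<open>I\<^sub>k(f)\<close>, so the error is the sum over the frequencies
  \<open>h = k + m n\<close> with \<open>m \<noteq> 0\<close>. By Bessel's inequality for the derivative of order \<open>s\<close>, the squares of
  \<open>(2 \<pi> |h|)\<^sup>s |I\<^sub>h(f)|\<close> add up to at most \<open>\<parallel>f\<parallel>\<^sup>2\<close>, and Cauchy--Schwarz leaves the number
  \<open>\<Sum> |k + m n|\<^sup>-\<^sup>2\<^sup>s\<close>. For \<open>n \<ge> 2 |k|\<close> one has \<open>3 |k + m n| \<ge> |2m \<plusminus> 1| (n + |k|)\<close>, with the sign of \<open>k\<close>, and
  \<open>\<Sum> |2m \<plusminus> 1|\<^sup>-\<^sup>2 \<le> 2\<close> over \<open>m \<noteq> 0\<close>; this yields the error bound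
  \<open>\<surd>2 (3 / (2 \<pi> (n + |k|)))\<^sup>s\<close> (\<open>minimal_error_upper_bound\<close>). The choice \<open>n = N - |k|\<close>, where \<open>N\<close> is the ceiling in the
  statement, makes this at most \<open>\<epsilon>\<close>. The choice is admissible since \<open>\<epsilon> < (2 \<pi> |k|)\<^sup>-\<^sup>s\<close> forces \<open>N > 3 |k|\<close>;
  for \<open>k = 0\<close> it only requires \<open>N\<close> to be positive.

  Without any function values the error is exactly \<open>(2 \<pi> |k|)\<^sup>-\<^sup>s\<close>, and at least 1 for \<open>k = 0\<close>: Bessel's inequality
  at the single frequency \<open>k\<close> gives one direction and a multiple of the \<open>k\<close>-th exponential the other.
  The first direction settles the case of large \<open>\<epsilon>\<close>. The second shows that the complexity \<open>n\<close> is
  positive for the remaining \<open>\<epsilon>\<close>, so that the assumed inequality \<open>c / (n + |k|)\<^sup>s \<le> \<epsilon>\<close> is available and can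
  be solved for \<open>n\<close>.

  Two facts of real analysis are behind this. The derivative of order \<open>s - 1\<close> is merely absolutely
  continuous, so integration by parts rests on the fundamental theorem of calculus for absolutely
  continuous functions (\<open>absolutely_continuous_FTC\<close>). Pointwise convergence of Fourier series follows from
  the formula \<open>g(y) = \<integral> g + \<integral> g' B\<^sub>y\<close> with the sawtooth \<open>B\<^sub>y\<close>, whose own Fourier series converges in \<open>L\<^sub>2\<close> by
  Bessel's identity and the Basel series.
\<close>

section \<open>Absolutely continuous functions\<close>

lemma absolutely_continuous_fun_onD:
  assumes "absolutely_continuous_fun_on S f" "\<epsilon> > 0"
  shows "\<exists>\<delta>>0. \<forall>\<D>. \<D> division_of \<Union>\<D> \<longrightarrow> \<Union>\<D> \<subseteq> S \<longrightarrow> (\<Sum>K\<in>\<D>. Sup K - Inf K) < \<delta> \<longrightarrow>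
      (\<Sum>K\<in>\<D>. norm (f (Sup K) - f (Inf K))) < \<epsilon>"
  using assms(1)[unfolded absolutely_continuous_fun_on_def, rule_format, OF assms(2)]
  by (simp add: imp_conjL)

lemma division_of_real_interval:
  fixes \<D> :: "real set set"
  assumes "\<D> division_of S" "K \<in> \<D>"
  obtains u v where "u \<le> v" "K = {u..v}" "Inf K = u" "Sup K = v"
proof -
  from division_ofD(3,4)[OF assms] obtain u v where "K = cbox u v" "K \<noteq> {}" by blast
  then have "u \<le> v" "K = {u..v}" by auto
  with that show thesis by simp
qed

text \<open>
  The argument is the gauge (Henstock--Kurzweil) one. Outside \<open>N\<close> the derivative controls the increment
    of \<open>f\<close> over a small tagged interval, as in the classical theorem. Tagged intervals with tag in \<open>N\<close> are
    forced by the gauge into an open set \<open>U\<close> of measure below \<open>\<delta>\<close>; since they do not overlap, their total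
    length is below \<open>\<delta>\<close>, and absolute continuity makes the sum of their increments small.
\<close>

lemma absolutely_continuous_FTC:
  fixes f f' :: "real \<Rightarrow> complex"
  assumes ac: "absolutely_continuous_fun_on S f" and ab: "a \<le> b" "{a..b} \<subseteq> S"
    and N: "negligible N"
    and deriv: "\<And>x. x \<in> {a..b} - N \<Longrightarrow> (f has_vector_derivative f' x) (at x within {a..b})"
  shows "(f' has_integral f b - f a) {a..b}"
proof -
  \<comment> \<open>Riemann sums must not see the arbitrary values of \<open>f'\<close> on \<open>N\<close>.\<close>
  define g where "g x = (if x \<in> N then 0 else f' x)" for x
  have "(g has_integral f b - f a) (cbox a b)"
    unfolding has_integral
  proof safe
    fix e :: real assume e: "e > 0"
    \<comment> \<open>The \<open>+ 1\<close> keeps the denominator positive when \<open>a = b\<close>.\<close>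
    define e1 where "e1 = e / (2 * (b - a + 1))"
    have e1: "e1 > 0" and e1': "e1 * (b - a) < e / 2"
      using e ab by (auto simp: e1_def field_simps)
    obtain \<delta> where \<delta>: "\<delta> > 0" and ac\<delta>:
      "\<forall>\<D>. \<D> division_of \<Union>\<D> \<longrightarrow> \<Union>\<D> \<subseteq> S \<longrightarrow> (\<Sum>K\<in>\<D>. Sup K - Inf K) < \<delta> \<longrightarrow>
        (\<Sum>K\<in>\<D>. norm (f (Sup K) - f (Inf K))) < e / 2"
      using absolutely_continuous_fun_onD[OF ac half_gt_zero[OF e]] by (elim exE conjE)
    have N0: "N \<in> null_sets lebesgue" "N \<in> sets lebesgue" "N \<in> lmeasurable"
      using N negligible_iff_null_sets negligible_imp_sets negligible_imp_measurable by blast+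
    obtain U where U: "open U" "N \<subseteq> U" and UN: "U - N \<in> lmeasurable"
      and Ue: "emeasure lebesgue (U - N) < ennreal \<delta>"
      using sets_lebesgue_outer_open[OF N0(2) \<delta>] .
    have "U = (U - N) \<union> N" using U by blast
    then have U3: "U \<in> lmeasurable"
      using UN N0(3) by (metis fmeasurable.Un)
    have "emeasure lebesgue U = emeasure lebesgue (U - N)"
      using N0(1) U3 by (simp add: emeasure_Diff_null_set fmeasurableD)
    with Ue U3 have "ennreal (measure lebesgue U) < ennreal \<delta>"
      by (simp add: emeasure_eq_measure2)
    then have U4: "measure lebesgue U < \<delta>"
      by (simp add: ennreal_less_iff)
    have "\<forall>x. \<exists>d>0. x \<in> {a..b} - N \<longrightarrow>
         (\<forall>y\<in>{a..b}. norm (y-x) < d \<longrightarrow> norm (f y - f x - (y-x) *\<^sub>R f' x) \<le> e1 * norm (y-x))"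
      using deriv[unfolded has_vector_derivative_def has_derivative_within_alt] e1
      by (metis zero_less_one)
    then obtain d where d: "\<And>x. 0 < d x"
      "\<And>x y. \<lbrakk>x \<in> {a..b} - N; y \<in> {a..b}; norm (y-x) < d x\<rbrakk>
         \<Longrightarrow> norm (f y - f x - (y-x) *\<^sub>R f' x) \<le> e1 * norm (y-x)"
      by metis
    define \<gamma> where "\<gamma> x = (if x \<in> N then U else ball x (d x))" for x
    have "gauge \<gamma>"
      using U d by (auto simp: gauge_def \<gamma>_def)
    have main: "norm ((\<Sum>(x, K)\<in>p. measure lborel K *\<^sub>R g x) - (f b - f a)) < e"
      if p: "p tagged_division_of cbox a b" "\<gamma> fine p" for p
    proof -
      define p1 p2 where "p1 = {(x, K) \<in> p. x \<notin> N}" and "p2 = {(x, K) \<in> p. x \<in> N}"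
      have fin: "finite p" using p(1) by blast
      have p12: "p = p1 \<union> p2" "p1 \<inter> p2 = {}" "p1 \<subseteq> p" "p2 \<subseteq> p"
        by (auto simp: p1_def p2_def)
      have fin12: "finite p1" "finite p2" using fin p12 finite_subset by blast+
      have inter: "\<exists>u v. u \<le> v \<and> K = {u..v} \<and> x \<in> K \<and> K \<subseteq> {a..b} \<and> Inf K = u \<and> Sup K = v"
        if xK: "(x, K) \<in> p" for x K
      proof -
        have "x \<in> K" "K \<subseteq> cbox a b" using tagged_division_ofD(2,3)[OF p(1) xK] by auto
        moreover obtain u v where "K = cbox u v" using tagged_division_ofD(4)[OF p(1) xK] by auto
        ultimately show ?thesis by (intro exI[of _ u] exI[of _ v]) auto
      qed
      have cont: "measure lborel K = Sup K - Inf K" if "(x, K) \<in> p" for x K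
      proof -
        from inter[OF that] obtain u v where "u \<le> v" "K = {u..v}" by blast
        then show ?thesis by simp
      qed
      have len_nonneg: "0 \<le> Sup K - Inf K" if "(x, K) \<in> p" for x K
        using inter[OF that] by auto
      have total: "(\<Sum>(x,K)\<in>p. Sup K - Inf K) = b - a" "(\<Sum>(x,K)\<in>p. f (Sup K) - f (Inf K)) = f b - f a"
        using additive_tagged_division_1[where f= "\<lambda>x. x"] additive_tagged_division_1[where f= f]
          ab(1) p(1) by auto
      define D where "D = (\<lambda>(x, K). measure lborel K *\<^sub>R g x - (f (Sup K) - f (Inf K)))"
      have "(\<Sum>(x, K)\<in>p. measure lborel K *\<^sub>R g x) - (f b - f a) = sum D p"
        unfolding total(2)[symmetric] D_def by (simp add: sum_subtractf[symmetric] split_def)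
      also have "\<dots> = sum D p1 + sum D p2"
        unfolding p12(1) by (rule sum.union_disjoint) (use fin12 p12 in auto)
      finally have eq: "(\<Sum>(x, K)\<in>p. measure lborel K *\<^sub>R g x) - (f b - f a) = sum D p1 + sum D p2" .
      have "norm (sum D p1) \<le> (\<Sum>z\<in>p1. e1 * (case z of (x, K) \<Rightarrow> Sup K - Inf K))"
      proof (rule sum_norm_le, safe)
        fix x K assume xK: "(x, K) \<in> p1"
        then have x: "x \<notin> N" and xKp: "(x, K) \<in> p" by (auto simp: p1_def)
        from inter[OF xKp] obtain u v where uv: "u \<le> v" "K = {u..v}" "x \<in> K" "K \<subseteq> {a..b}"
          "Inf K = u" "Sup K = v" by blast
        have "K \<subseteq> ball x (d x)" using p(2) xKp x by (force simp: fine_def \<gamma>_def)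
        moreover have "u \<in> K" "v \<in> K" using uv by auto
        ultimately have "u \<in> ball x (d x)" "v \<in> ball x (d x)" by blast+
        then have du: "norm (f u - f x - (u-x) *\<^sub>R f' x) \<le> e1 * norm (u-x)"
          and dv: "norm (f v - f x - (v-x) *\<^sub>R f' x) \<le> e1 * norm (v-x)"
          using d(2)[of x u] d(2)[of x v] uv x by (auto simp: dist_real_def)
        have Deq: "D (x, K) = (f u - f x - (u-x) *\<^sub>R f' x) - (f v - f x - (v-x) *\<^sub>R f' x)"
          using uv x by (simp add: D_def g_def algebra_simps)
        have "norm (D (x, K)) \<le> e1 * norm (u-x) + e1 * norm (v-x)"
          unfolding Deq using du dv norm_triangle_ineq4[of "f u - f x - (u-x) *\<^sub>R f' x" "f v - f x - (v-x) *\<^sub>R f' x"]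
          by linarith
        also have "\<dots> = e1 * (v - u)" using uv by (simp add: algebra_simps)
        finally show "norm (D (x, K)) \<le> e1 * (Sup K - Inf K)" using uv by simp
      qed
      also have "\<dots> \<le> (\<Sum>z\<in>p. e1 * (case z of (x, K) \<Rightarrow> Sup K - Inf K))"
      proof (rule sum_mono2[OF fin p12(3)], safe)
        fix x K assume "(x, K) \<in> p"
        then show "0 \<le> e1 * (Sup K - Inf K)" using len_nonneg e1 by (metis mult_nonneg_nonneg less_imp_le)
      qed
      also have "\<dots> = e1 * (b - a)" unfolding total(1)[symmetric] by (simp only: sum_distrib_left)
      finally have s1: "norm (sum D p1) < e / 2" using e1' by linarith
      define \<D> where "\<D> = snd ` p2"
      have "p2 tagged_partial_division_of cbox a b"
        using p(1) p12(4) tagged_partial_division_subset tagged_division_of_def by blast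
      then have p2': "p2 tagged_division_of \<Union>\<D>"
        unfolding \<D>_def by (rule tagged_partial_division_of_Union_self)
      then have \<D>: "\<D> division_of \<Union>\<D>" unfolding \<D>_def by (rule division_of_tagged_division)
      have \<D>ab: "\<Union>\<D> \<subseteq> {a..b}"
        using inter p12(4) unfolding \<D>_def by fastforce
      have \<D>U: "\<Union>\<D> \<subseteq> U"
        using p(2) unfolding \<D>_def p2_def fine_def \<gamma>_def by fastforce
      have "(\<Sum>K\<in>\<D>. Sup K - Inf K) = (\<Sum>K\<in>\<D>. measure lebesgue K)"
      proof (rule sum.cong)
        fix K assume "K \<in> \<D>"
        then obtain x where "(x, K) \<in> p" using p12(4) by (auto simp: \<D>_def)
        with inter obtain u v where "u \<le> v" "K = {u..v}" by blast
        then show "Sup K - Inf K = measure lebesgue K" by simp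
      qed simp
      also have "\<dots> = measure lebesgue (\<Union>\<D>)" by (rule content_division[OF \<D>])
      also have "\<dots> \<le> measure lebesgue U"
        by (rule measure_mono_fmeasurable[OF \<D>U]) (use lmeasurable_division[OF \<D>] U3 in auto)
      finally have "(\<Sum>K\<in>\<D>. norm (f (Sup K) - f (Inf K))) < e / 2"
        using U4 \<D> \<D>ab ab by (intro ac\<delta>[rule_format]) auto
      \<comment> \<open>Passing from intervals to tagged intervals wants a summand that vanishes on the empty interval,
        where \<open>Sup\<close> and \<open>Inf\<close> are arbitrary.\<close>
      also have "(\<Sum>K\<in>\<D>. norm (f (Sup K) - f (Inf K)))
          = (\<Sum>K\<in>\<D>. if K = {} then 0 else norm (f (Sup K) - f (Inf K)))"
        using division_ofD(3)[OF \<D>] by (intro sum.cong) auto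
      also have "\<dots> = (\<Sum>(x, K)\<in>p2. if K = {} then 0 else norm (f (Sup K) - f (Inf K)))"
        unfolding \<D>_def
        by (rule sum.over_tagged_division_lemma[OF p2'[unfolded \<D>_def], symmetric])
          (auto simp: box_eq_empty)
      also have "\<dots> = (\<Sum>(x, K)\<in>p2. norm (f (Sup K) - f (Inf K)))"
        using tagged_division_ofD(2)[OF p2'] by (intro sum.cong refl) (fastforce split: prod.split)
      finally have "(\<Sum>(x, K)\<in>p2. norm (f (Sup K) - f (Inf K))) < e / 2" .
      moreover have "norm (sum D p2) \<le> (\<Sum>(x, K)\<in>p2. norm (f (Sup K) - f (Inf K)))"
        by (rule sum_norm_le) (auto simp: D_def p2_def g_def norm_minus_commute)
      ultimately have s2: "norm (sum D p2) < e / 2" by linarith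
      show ?thesis unfolding eq using norm_triangle_ineq[of "sum D p1" "sum D p2"] s1 s2 by linarith
    qed
    show "\<exists>\<gamma>. gauge \<gamma> \<and> (\<forall>p. p tagged_division_of cbox a b \<and> \<gamma> fine p \<longrightarrow>
        norm ((\<Sum>(x, K)\<in>p. measure lborel K *\<^sub>R g x) - (f b - f a)) < e)"
    proof (intro exI[of _ \<gamma>] conjI allI impI)
      show "gauge \<gamma>" by fact
      show "norm ((\<Sum>(x, K)\<in>p. measure lborel K *\<^sub>R g x) - (f b - f a)) < e"
        if "p tagged_division_of cbox a b \<and> \<gamma> fine p" for p
        using that by (elim conjE) (rule main)
    qed
  qed
  then have "(g has_integral f b - f a) {a..b}" by simp
  then show ?thesis by (rule has_integral_spike[OF N, rotated]) (simp add: g_def)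
qed

lemma Lipschitz_imp_absolutely_continuous:
  fixes f :: "real \<Rightarrow> complex"
  assumes L: "\<And>x y. x \<in> S \<Longrightarrow> y \<in> S \<Longrightarrow> norm (f x - f y) \<le> B * \<bar>x - y\<bar>"
  shows "absolutely_continuous_fun_on S f"
  unfolding absolutely_continuous_fun_on_def
proof (intro allI impI)
  fix e :: real assume e: "e > 0"
  define C where "C = max B 1"
  have C: "C > 0" "B \<le> C" by (auto simp: C_def)
  have "(\<Sum>K\<in>\<D>. norm (f (Sup K) - f (Inf K))) < e"
    if D: "\<D> division_of \<Union>\<D>" "\<Union>\<D> \<subseteq> S" "(\<Sum>K\<in>\<D>. Sup K - Inf K) < e / C" for \<D>
  proof -
    have "(\<Sum>K\<in>\<D>. norm (f (Sup K) - f (Inf K))) \<le> (\<Sum>K\<in>\<D>. C * (Sup K - Inf K))"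
    proof (rule sum_mono)
      fix K assume K: "K \<in> \<D>"
      obtain u v where uv: "u \<le> v" "K = {u..v}" "Inf K = u" "Sup K = v"
        using division_of_real_interval[OF D(1) K] .
      have "u \<in> K" "v \<in> K" using uv by auto
      then have "u \<in> S" "v \<in> S" using D(2) K by blast+
      from L[OF this(2) this(1)] have "norm (f v - f u) \<le> B * (v - u)" using uv by simp
      also have "\<dots> \<le> C * (v - u)" using uv C by (intro mult_right_mono) auto
      finally show "norm (f (Sup K) - f (Inf K)) \<le> C * (Sup K - Inf K)" using uv by simp
    qed
    also have "\<dots> = C * (\<Sum>K\<in>\<D>. Sup K - Inf K)" by (simp add: sum_distrib_left)
    also have "\<dots> < e" using D(3) C by (simp add: field_simps)
    finally show ?thesis .
  qed
  then show "\<exists>\<delta>>0. \<forall>\<D>. \<D> division_of \<Union>\<D> \<and> \<Union>\<D> \<subseteq> S \<and> (\<Sum>K\<in>\<D>. Sup K - Inf K) < \<delta> \<longrightarrow>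
      (\<Sum>K\<in>\<D>. norm (f (Sup K) - f (Inf K))) < e"
    using e C by (intro exI[of _ "e / C"]) auto
qed

lemma absolutely_continuous_imp_continuous_on:
  fixes f :: "real \<Rightarrow> complex"
  assumes ac: "absolutely_continuous_fun_on {a..b} f"
  shows "continuous_on {a..b} f"
  unfolding continuous_on_iff
proof safe
  fix x e :: real assume x: "x \<in> {a..b}" and e: "e > 0"
  obtain \<delta> where \<delta>: "\<delta> > 0" and ac\<delta>:
      "\<forall>\<D>. \<D> division_of \<Union>\<D> \<longrightarrow> \<Union>\<D> \<subseteq> {a..b} \<longrightarrow> (\<Sum>K\<in>\<D>. Sup K - Inf K) < \<delta> \<longrightarrow>
        (\<Sum>K\<in>\<D>. norm (f (Sup K) - f (Inf K))) < e"
    using absolutely_continuous_fun_onD[OF ac e] by (elim exE conjE)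
  have step: "norm (f v - f u) < e" if "u \<in> {a..b}" "v \<in> {a..b}" "u \<le> v" "v - u < \<delta>" for u v
  proof -
    have "{{u..v}} division_of \<Union>{{u..v}}" using that division_of_self[of u v] by auto
    from ac\<delta>[rule_format, OF this] show ?thesis using that by auto
  qed
  show "\<exists>d>0. \<forall>y\<in>{a..b}. dist y x < d \<longrightarrow> dist (f y) (f x) < e"
  proof (intro exI[of _ \<delta>] conjI \<delta> ballI impI)
    fix y assume "y \<in> {a..b}" "dist y x < \<delta>"
    then show "dist (f y) (f x) < e"
      using step[of x y] step[of y x] x
      by (cases "x \<le> y") (auto simp: dist_norm norm_minus_commute)
  qed
qed

lemma absolutely_continuous_mult:
  fixes f g :: "real \<Rightarrow> complex"
  assumes f: "absolutely_continuous_fun_on {a..b} f" and g: "absolutely_continuous_fun_on {a..b} g"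
  shows "absolutely_continuous_fun_on {a..b} (\<lambda>x. f x * g x)"
proof -
  have "bounded (f ` {a..b})" "bounded (g ` {a..b})"
    using absolutely_continuous_imp_continuous_on f g
    by (auto intro!: compact_imp_bounded compact_continuous_image)
  then obtain A B where A: "A > 0" "\<And>x. x \<in> {a..b} \<Longrightarrow> norm (f x) \<le> A"
    and B: "B > 0" "\<And>x. x \<in> {a..b} \<Longrightarrow> norm (g x) \<le> B"
    unfolding bounded_pos by auto
  show ?thesis
    unfolding absolutely_continuous_fun_on_def
  proof (intro allI impI)
    fix e :: real assume e: "e > 0"
    have eB: "e / (2 * B) > 0" and eA: "e / (2 * A) > 0" using e A B by auto
    obtain \<delta>1 where \<delta>1: "\<delta>1 > 0" and ac1:
      "\<forall>\<D>. \<D> division_of \<Union>\<D> \<longrightarrow> \<Union>\<D> \<subseteq> {a..b} \<longrightarrow> (\<Sum>K\<in>\<D>. Sup K - Inf K) < \<delta>1 \<longrightarrow>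
        (\<Sum>K\<in>\<D>. norm (f (Sup K) - f (Inf K))) < e / (2 * B)"
      using absolutely_continuous_fun_onD[OF f eB] by (elim exE conjE)
    obtain \<delta>2 where \<delta>2: "\<delta>2 > 0" and ac2:
      "\<forall>\<D>. \<D> division_of \<Union>\<D> \<longrightarrow> \<Union>\<D> \<subseteq> {a..b} \<longrightarrow> (\<Sum>K\<in>\<D>. Sup K - Inf K) < \<delta>2 \<longrightarrow>
        (\<Sum>K\<in>\<D>. norm (g (Sup K) - g (Inf K))) < e / (2 * A)"
      using absolutely_continuous_fun_onD[OF g eA] by (elim exE conjE)
    have "(\<Sum>K\<in>\<D>. norm (f (Sup K) * g (Sup K) - f (Inf K) * g (Inf K))) < e"
      if D: "\<D> division_of \<Union>\<D>" "\<Union>\<D> \<subseteq> {a..b}" "(\<Sum>K\<in>\<D>. Sup K - Inf K) < min \<delta>1 \<delta>2" for \<D>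
    proof -
      have "(\<Sum>K\<in>\<D>. norm (f (Sup K) * g (Sup K) - f (Inf K) * g (Inf K)))
        \<le> (\<Sum>K\<in>\<D>. B * norm (f (Sup K) - f (Inf K)) + A * norm (g (Sup K) - g (Inf K)))"
      proof (rule sum_mono)
        fix K assume K: "K \<in> \<D>"
        obtain u v where uv: "u \<le> v" "K = {u..v}" "Inf K = u" "Sup K = v"
          using division_of_real_interval[OF D(1) K] .
        have "u \<in> K" "v \<in> K" using uv by auto
        then have uvab: "u \<in> {a..b}" "v \<in> {a..b}" using D(2) K by blast+
        have "f v * g v - f u * g u = (f v - f u) * g v + f u * (g v - g u)" by (simp add: algebra_simps)
        also have "norm \<dots> \<le> norm (f v - f u) * norm (g v) + norm (f u) * norm (g v - g u)"
          by (metis norm_mult norm_triangle_ineq)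
        also have "\<dots> \<le> norm (f v - f u) * B + A * norm (g v - g u)"
          by (intro add_mono mult_left_mono mult_right_mono A B uvab) auto
        finally show "norm (f (Sup K) * g (Sup K) - f (Inf K) * g (Inf K))
          \<le> B * norm (f (Sup K) - f (Inf K)) + A * norm (g (Sup K) - g (Inf K))"
          using uv by (simp add: mult.commute)
      qed
      also have "\<dots> = B * (\<Sum>K\<in>\<D>. norm (f (Sup K) - f (Inf K))) + A * (\<Sum>K\<in>\<D>. norm (g (Sup K) - g (Inf K)))"
        by (simp add: sum.distrib sum_distrib_left)
      also have "\<dots> < B * (e / (2 * B)) + A * (e / (2 * A))"
        using ac1[rule_format, of \<D>] ac2[rule_format, of \<D>] D A B by (intro add_strict_mono mult_strict_left_mono) auto
      also have "\<dots> = e" using A B by simp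
      finally show ?thesis .
    qed
    then show "\<exists>\<delta>>0. \<forall>\<D>. \<D> division_of \<Union>\<D> \<and> \<Union>\<D> \<subseteq> {a..b} \<and> (\<Sum>K\<in>\<D>. Sup K - Inf K) < \<delta> \<longrightarrow>
      (\<Sum>K\<in>\<D>. norm (f (Sup K) * g (Sup K) - f (Inf K) * g (Inf K))) < e"
      using \<delta>1 \<delta>2 by (intro exI[of _ "min \<delta>1 \<delta>2"]) auto
  qed
qed

lemma continuously_differentiable_imp_absolutely_continuous:
  fixes f f' :: "real \<Rightarrow> complex"
  assumes d: "\<And>x. x \<in> {a..b} \<Longrightarrow> (f has_vector_derivative f' x) (at x within {a..b})"
    and c: "continuous_on {a..b} f'"
  shows "absolutely_continuous_fun_on {a..b} f"
proof -
  have "bounded (f' ` {a..b})"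
    using c by (auto intro!: compact_imp_bounded compact_continuous_image)
  then obtain B where B: "\<And>x. x \<in> {a..b} \<Longrightarrow> norm (f' x) \<le> B"
    unfolding bounded_iff by (elim exE) (rule that, blast)
  show ?thesis
  proof (rule Lipschitz_imp_absolutely_continuous[where B = B])
    fix x y assume xy: "x \<in> {a..b}" "y \<in> {a..b}"
    have "norm (f x - f y) \<le> B * norm (x - y)"
    proof (rule differentiable_bound[where S = "{a..b}"])
      show "(f has_derivative (\<lambda>h. h *\<^sub>R f' z)) (at z within {a..b})" if "z \<in> {a..b}" for z
        using d[OF that] by (simp add: has_vector_derivative_def)
      show "onorm (\<lambda>h. h *\<^sub>R f' z) \<le> B" if "z \<in> {a..b}" for z
        using B[OF that] onorm_scaleR_left[of "\<lambda>h::real. h" "f' z"] bounded_linear_ident onorm_id_le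
        by (simp add: onorm_id)
    qed (use xy in auto)
    then show "norm (f x - f y) \<le> B * \<bar>x - y\<bar>" by simp
  qed
qed

text \<open>
  The product of \<open>f\<close> with a continuously differentiable \<open>\<phi>\<close> is again absolutely continuous, so this is the
    fundamental theorem applied to \<open>f \<phi>\<close>.
\<close>

lemma absolutely_continuous_integration_by_parts:
  fixes f f' \<phi> \<phi>' :: "real \<Rightarrow> complex"
  assumes ac: "absolutely_continuous_fun_on {a..b} f" and ab: "a \<le> b" and N: "negligible N"
    and f': "\<And>x. x \<in> {a..b} - N \<Longrightarrow> (f has_vector_derivative f' x) (at x within {a..b})"
    and \<phi>': "\<And>x. x \<in> {a..b} \<Longrightarrow> (\<phi> has_vector_derivative \<phi>' x) (at x within {a..b})"
    and c: "continuous_on {a..b} \<phi>'"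
  shows "((\<lambda>x. f' x * \<phi> x + f x * \<phi>' x) has_integral f b * \<phi> b - f a * \<phi> a) {a..b}"
proof (rule absolutely_continuous_FTC[OF _ ab order_refl N])
  show "absolutely_continuous_fun_on {a..b} (\<lambda>x. f x * \<phi> x)"
    by (intro absolutely_continuous_mult ac continuously_differentiable_imp_absolutely_continuous[OF \<phi>' c])
  show "((\<lambda>x. f x * \<phi> x) has_vector_derivative f' x * \<phi> x + f x * \<phi>' x) (at x within {a..b})"
    if "x \<in> {a..b} - N" for x
    using has_vector_derivative_mult[OF f'[OF that] \<phi>'[of x]] that by (simp add: add.commute)
qed

section \<open>Square-integrable functions on the unit interval\<close>

lemma integrable_const_unit [simp]: "integrable unit_leb (\<lambda>x. c :: 'b::euclidean_space)"
  by (rule continuous_imp_integrable_real) simp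

lemma measure_unit_leb [simp]: "measure unit_leb {0..1} = 1"
  by (simp add: measure_restrict_space)

lemma square_integrable_mult:
  assumes "square_integrable_on_unit u" "square_integrable_on_unit v"
  shows "integrable unit_leb (\<lambda>x. u x * v x)"
proof (rule Bochner_Integration.integrable_bound)
  show "integrable unit_leb (\<lambda>x. (norm (u x))\<^sup>2 + (norm (v x))\<^sup>2)"
    using assms by (simp add: square_integrable_on_unit_def)
  show "(\<lambda>x. u x * v x) \<in> borel_measurable unit_leb"
    using assms by (auto simp: square_integrable_on_unit_def intro!: borel_measurable_times)
  have "norm (a * b) \<le> norm ((norm a)\<^sup>2 + (norm b)\<^sup>2)" for a b :: complex
  proof -
    have "0 \<le> norm a * norm b" by simp
    with sum_squares_bound[of "norm a" "norm b"]
    have "norm a * norm b \<le> (norm a)\<^sup>2 + (norm b)\<^sup>2" by linarith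
    then show ?thesis by (simp add: norm_mult)
  qed
  then show "AE x in unit_leb. norm (u x * v x) \<le> norm ((norm (u x))\<^sup>2 + (norm (v x))\<^sup>2)" by simp
qed

lemma continuous_imp_square_integrable:
  assumes "continuous_on {0..1} f"
  shows "square_integrable_on_unit f"
  unfolding square_integrable_on_unit_def
  using assms by (intro conjI continuous_imp_measurable_on_sets_lebesgue continuous_imp_integrable_real
      continuous_intros) auto

lemma square_integrable_imp_integrable:
  assumes "square_integrable_on_unit f"
  shows "integrable unit_leb f"
  using square_integrable_mult[OF assms continuous_imp_square_integrable[of "\<lambda>_. 1"]] by simp

lemma square_integrable_diff:
  assumes "square_integrable_on_unit u" "square_integrable_on_unit v"
  shows "square_integrable_on_unit (\<lambda>x. u x - v x)"
  unfolding square_integrable_on_unit_def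
proof
  show m: "(\<lambda>x. u x - v x) \<in> borel_measurable unit_leb"
    using assms by (auto simp: square_integrable_on_unit_def intro!: borel_measurable_diff)
  show "integrable unit_leb (\<lambda>x. (norm (u x - v x))\<^sup>2)"
  proof (rule Bochner_Integration.integrable_bound)
    show "integrable unit_leb (\<lambda>x. 2 * (norm (u x))\<^sup>2 + 2 * (norm (v x))\<^sup>2)"
      using assms by (simp add: square_integrable_on_unit_def)
    show "(\<lambda>x. (norm (u x - v x))\<^sup>2) \<in> borel_measurable unit_leb" using m by simp
    have "(norm (a - b))\<^sup>2 \<le> 2 * (norm a)\<^sup>2 + 2 * (norm b)\<^sup>2" for a b :: complex
    proof -
      have "(norm (a - b))\<^sup>2 \<le> (norm a + norm b)\<^sup>2"
        by (intro power_mono norm_triangle_ineq4) auto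
      also have "\<dots> \<le> 2 * (norm a)\<^sup>2 + 2 * (norm b)\<^sup>2"
        using sum_squares_bound[of "norm a" "norm b"] by (simp add: power2_sum)
      finally show ?thesis .
    qed
    then show "AE x in unit_leb. norm ((norm (u x - v x))\<^sup>2) \<le> norm (2 * (norm (u x))\<^sup>2 + 2 * (norm (v x))\<^sup>2)"
      by (intro AE_I2) (simp add: abs_of_nonneg)
  qed
qed

lemma square_integrable_cmult:
  assumes "square_integrable_on_unit u"
  shows "square_integrable_on_unit (\<lambda>x. c * u x)"
  using assms by (auto simp: square_integrable_on_unit_def norm_mult power_mult_distrib)

lemma square_integrable_cnj:
  assumes "square_integrable_on_unit u"
  shows "square_integrable_on_unit (\<lambda>x. cnj (u x))"
  using assms by (auto simp: square_integrable_on_unit_def intro!: borel_measurable_continuous_on[OF continuous_on_cnj, OF continuous_on_id])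

lemma square_integrable_sum:
  assumes "finite H" "\<And>h. h \<in> H \<Longrightarrow> square_integrable_on_unit (u h)"
  shows "square_integrable_on_unit (\<lambda>x. \<Sum>h\<in>H. u h x)"
  using assms
proof (induction H rule: finite_induct)
  case empty
  then show ?case by (simp add: continuous_imp_square_integrable)
next
  case (insert h H)
  have "square_integrable_on_unit (\<lambda>x. u h x - (-1) * (\<Sum>h\<in>H. u h x))"
    by (intro square_integrable_diff square_integrable_cmult insert) (use insert in auto)
  then show ?case using insert by simp
qed

lemma Cauchy_Schwarz_unit:
  assumes u: "square_integrable_on_unit u" and v: "square_integrable_on_unit v"
  shows "norm (\<integral>x. u x * v x \<partial>unit_leb)
    \<le> sqrt (\<integral>x. (norm (u x))\<^sup>2 \<partial>unit_leb) * sqrt (\<integral>x. (norm (v x))\<^sup>2 \<partial>unit_leb)"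
proof -
  define A B C where "A = (\<integral>x. (norm (u x))\<^sup>2 \<partial>unit_leb)" and "B = (\<integral>x. (norm (v x))\<^sup>2 \<partial>unit_leb)"
    and "C = (\<integral>x. norm (u x) * norm (v x) \<partial>unit_leb)"
  have iA: "integrable unit_leb (\<lambda>x. (norm (u x))\<^sup>2)" and iB: "integrable unit_leb (\<lambda>x. (norm (v x))\<^sup>2)"
    using u v by (auto simp: square_integrable_on_unit_def)
  have iC: "integrable unit_leb (\<lambda>x. norm (u x) * norm (v x))"
    using integrable_norm[OF square_integrable_mult[OF u v]] by (simp add: norm_mult)
  have nn: "A \<ge> 0" "B \<ge> 0" "C \<ge> 0" unfolding A_def B_def C_def by simp_all
  have "norm (\<integral>x. u x * v x \<partial>unit_leb) \<le> C"
    unfolding C_def using integral_norm_bound[of unit_leb "\<lambda>x. u x * v x"] by (simp add: norm_mult)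
  also have "C \<le> sqrt A * sqrt B"
  proof -
    \<comment> \<open>The quadratic polynomial \<open>\<integral> (t |u| - |v|)\<^sup>2\<close> in \<open>t\<close> is nonnegative.\<close>
    have quad: "2 * t * C \<le> t\<^sup>2 * A + B" for t :: real
    proof -
      have "0 \<le> (\<integral>x. (t * norm (u x) - norm (v x))\<^sup>2 \<partial>unit_leb)" by simp
      also have "(\<lambda>x. (t * norm (u x) - norm (v x))\<^sup>2)
        = (\<lambda>x. t\<^sup>2 * (norm (u x))\<^sup>2 - 2 * t * (norm (u x) * norm (v x)) + (norm (v x))\<^sup>2)"
        by (auto simp: power2_diff power_mult_distrib)
      also have "(\<integral>x. \<dots> x \<partial>unit_leb) = t\<^sup>2 * A - 2 * t * C + B"
        unfolding A_def B_def C_def using iA iB iC by simp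
      finally show ?thesis by simp
    qed
    have "C\<^sup>2 \<le> A * B"
    proof (cases "A = 0")
      case True
      have "C = 0"
      proof (rule ccontr)
        assume "C \<noteq> 0"
        then show False using quad[of "(B + 1) / C"] True nn by simp
      qed
      then show ?thesis using nn by simp
    next
      case False
      then show ?thesis using quad[of "C / A"] nn
        by (simp add: power2_eq_square field_simps)
    qed
    then show ?thesis by (metis nn(3) real_le_rsqrt real_sqrt_mult)
  qed
  finally show ?thesis unfolding A_def B_def .
qed

section \<open>Fourier coefficients and Bessel's identity\<close>

definition fourier_mode :: "int \<Rightarrow> real \<Rightarrow> complex" where
  "fourier_mode h x = cis (2 * pi * of_int h * x)"

lemma fourier_mode_mult: "fourier_mode h x * fourier_mode l x = fourier_mode (h + l) x"
  by (simp add: fourier_mode_def cis_mult algebra_simps)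

lemma fourier_mode_0 [simp]: "fourier_mode 0 x = 1" "fourier_mode h 0 = 1"
  by (auto simp: fourier_mode_def)

lemma fourier_mode_1 [simp]: "fourier_mode h 1 = 1"
  using cis_multiple_2pi[of "of_int h"] by (simp add: fourier_mode_def)

lemma cnj_fourier_mode [simp]: "cnj (fourier_mode h x) = fourier_mode (- h) x"
  by (simp add: fourier_mode_def cis_cnj)

lemma norm_fourier_mode [simp]: "norm (fourier_mode h x) = 1"
  by (simp add: fourier_mode_def)

lemma fourier_mode_has_vector_derivative:
  "(fourier_mode h has_vector_derivative 2 * of_real pi * \<i> * of_int h * fourier_mode h x) (at x within S)"
proof -
  let ?c = "2 * of_real pi * \<i> * of_int h"
  have "((\<lambda>z. exp (?c * z)) has_field_derivative ?c * exp (?c * of_real x)) (at (of_real x))"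
    by (auto intro!: derivative_eq_intros)
  from has_vector_derivative_real_field[OF this] show ?thesis
    by (simp add: fourier_mode_def[abs_def] cis_conv_exp algebra_simps)
qed

lemma continuous_on_fourier_mode [continuous_intros]: "continuous_on S (fourier_mode h)"
  unfolding continuous_on_eq_continuous_within
  by (intro ballI has_vector_derivative_continuous[OF fourier_mode_has_vector_derivative])

lemma square_integrable_fourier_mode: "square_integrable_on_unit (fourier_mode h)"
  by (intro continuous_imp_square_integrable continuous_intros)

lemma osc_integral_eq_fourier_coefficient:
  "osc_integral k f = (\<integral>x. f x * fourier_mode (- k) x \<partial>unit_leb)"
  by (simp add: osc_integral_def fourier_mode_def cis_conv_exp algebra_simps)

lemma integral_fourier_mode: "(\<integral>x. fourier_mode h x \<partial>unit_leb) = (if h = 0 then 1 else 0)"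
proof (cases "h = 0")
  case True
  have "fourier_mode 0 = (\<lambda>_. 1)" by auto
  then show ?thesis using True by simp
next
  case False
  have "(\<integral>x. fourier_mode h x \<partial>unit_leb) = integral {0..1} (fourier_mode h)"
    by (rule lebesgue_integral_eq_integral) (auto intro!: continuous_imp_integrable_real continuous_intros)
  moreover have "((\<lambda>x. 2 * of_real pi * \<i> * of_int h * fourier_mode h x) has_integral fourier_mode h 1 - fourier_mode h 0) {0..1}"
    by (rule fundamental_theorem_of_calculus) (auto intro: fourier_mode_has_vector_derivative)
  then have "((\<lambda>x. 2 * of_real pi * \<i> * of_int h * fourier_mode h x) has_integral 0) {0..1}" by simp
  from has_integral_mult_right[OF this, of "1 / (2 * of_real pi * \<i> * of_int h)"]
  have "(fourier_mode h has_integral 0) {0..1}" using False by simp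
  ultimately show ?thesis using False by (simp add: integral_unique)
qed

lemma osc_integral_fourier_mode: "osc_integral h (fourier_mode l) = (if h = l then 1 else 0)"
  by (auto simp: osc_integral_eq_fourier_coefficient fourier_mode_mult integral_fourier_mode)

lemma osc_integral_diff:
  assumes "square_integrable_on_unit u" "square_integrable_on_unit v"
  shows "osc_integral h (\<lambda>x. u x - v x) = osc_integral h u - osc_integral h v"
  unfolding osc_integral_eq_fourier_coefficient left_diff_distrib
  by (intro Bochner_Integration.integral_diff square_integrable_mult assms square_integrable_fourier_mode)

lemma osc_integral_cmult: "osc_integral h (\<lambda>x. c * u x) = c * osc_integral h u"
  by (simp add: osc_integral_eq_fourier_coefficient mult.assoc)

lemma osc_integral_fourier_sum:
  assumes "finite H"
  shows "osc_integral h (\<lambda>x. \<Sum>l\<in>H. c l * fourier_mode l x) = (if h \<in> H then c h else 0)"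
proof -
  have "osc_integral h (\<lambda>x. \<Sum>l\<in>H. c l * fourier_mode l x)
    = (\<integral>x. (\<Sum>l\<in>H. c l * (fourier_mode l x * fourier_mode (- h) x)) \<partial>unit_leb)"
    by (simp add: osc_integral_eq_fourier_coefficient sum_distrib_right mult.assoc)
  also have "\<dots> = (\<Sum>l\<in>H. c l * osc_integral h (fourier_mode l))"
    unfolding osc_integral_eq_fourier_coefficient
    by (subst Bochner_Integration.integral_sum)
      (auto intro!: integrable_mult_right square_integrable_mult square_integrable_fourier_mode)
  also have "\<dots> = (if h \<in> H then c h else 0)"
    using assms by (simp add: osc_integral_fourier_mode mult_delta_right)
  finally show ?thesis .
qed

lemma norm_sq_diff_fourier_mode:
  assumes r: "square_integrable_on_unit r"
  shows "(\<integral>x. (norm (r x - c * fourier_mode h x))\<^sup>2 \<partial>unit_leb)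
    = (\<integral>x. (norm (r x))\<^sup>2 \<partial>unit_leb) - 2 * Re (cnj c * osc_integral h r) + (norm c)\<^sup>2"
proof -
  have "(norm (r x - c * fourier_mode h x))\<^sup>2
     = (norm (r x))\<^sup>2 - 2 * Re (cnj c * (r x * fourier_mode (- h) x)) + (norm c)\<^sup>2" for x
  proof -
    have "of_real ((norm (r x - c * fourier_mode h x))\<^sup>2)
      = (r x - c * fourier_mode h x) * cnj (r x - c * fourier_mode h x)"
      by (simp only: complex_norm_square)
    also have "\<dots> = r x * cnj (r x) - (cnj c * (r x * fourier_mode (- h) x) + cnj (cnj c * (r x * fourier_mode (- h) x)))
       + c * cnj c * (fourier_mode h x * fourier_mode (- h) x)"
      by (simp add: algebra_simps)
    also have "\<dots> = of_real ((norm (r x))\<^sup>2 - 2 * Re (cnj c * (r x * fourier_mode (- h) x)) + (norm c)\<^sup>2)"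
      by (simp only: complex_add_cnj fourier_mode_mult complex_norm_square[symmetric]) simp
    finally show ?thesis unfolding of_real_eq_iff .
  qed
  moreover have i: "integrable unit_leb (\<lambda>x. cnj c * (r x * fourier_mode (- h) x))"
    by (intro integrable_mult_right square_integrable_mult r square_integrable_fourier_mode)
  moreover have "integrable unit_leb (\<lambda>x. (norm (r x))\<^sup>2)"
    using r by (simp add: square_integrable_on_unit_def)
  moreover have "(\<integral>x. (norm c)\<^sup>2 \<partial>unit_leb) = (norm c)\<^sup>2"
    using lebesgue_integral_eq_integral[of "{0..1::real}" "\<lambda>x. (norm c)\<^sup>2"] by simp
  moreover have "(\<integral>x. Re (cnj c * (r x * fourier_mode (- h) x)) \<partial>unit_leb) = Re (cnj c * osc_integral h r)"
    using integral_bounded_linear[OF bounded_linear_Re i]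
    by (simp add: osc_integral_eq_fourier_coefficient del: times_complex.sel)
  moreover have "integrable unit_leb (\<lambda>x. Re (cnj c * (r x * fourier_mode (- h) x)))"
    using integrable_bounded_linear[OF bounded_linear_Re i] .
  ultimately show ?thesis
    by (simp del: times_complex.sel)
qed

text \<open>
  Each step of the induction subtracts one more mode. The residual is orthogonal to the modes already
    subtracted, hence its coefficient at the new frequency is still that of \<open>g\<close>, and its squared norm
    drops by exactly the square of that coefficient. The identity, and not only the inequality that
    follows from it, is used: for the sawtooth it measures the remainder of the Fourier series.
\<close>

lemma Bessel_identity:
  assumes g: "square_integrable_on_unit g" and "finite H"
  shows "(\<integral>x. (norm (g x - (\<Sum>h\<in>H. osc_integral h g * fourier_mode h x)))\<^sup>2 \<partial>unit_leb)
    = (\<integral>x. (norm (g x))\<^sup>2 \<partial>unit_leb) - (\<Sum>h\<in>H. (norm (osc_integral h g))\<^sup>2)"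
  using assms(2)
proof (induction H rule: finite_induct)
  case empty
  then show ?case by simp
next
  case (insert l H)
  define r where "r x = g x - (\<Sum>h\<in>H. osc_integral h g * fourier_mode h x)" for x
  have p: "square_integrable_on_unit (\<lambda>x. \<Sum>h\<in>H. osc_integral h g * fourier_mode h x)"
    by (intro square_integrable_sum square_integrable_cmult square_integrable_fourier_mode insert)
  have r: "square_integrable_on_unit r"
    unfolding r_def by (intro square_integrable_diff g p)
  have c: "osc_integral l r = osc_integral l g"
    unfolding r_def osc_integral_diff[OF g p] osc_integral_fourier_sum[OF insert.hyps(1)]
    using insert by simp
  have "(\<integral>x. (norm (g x - (\<Sum>h\<in>insert l H. osc_integral h g * fourier_mode h x)))\<^sup>2 \<partial>unit_leb)
    = (\<integral>x. (norm (r x - osc_integral l g * fourier_mode l x))\<^sup>2 \<partial>unit_leb)"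
    using insert by (simp add: r_def algebra_simps)
  also have "\<dots> = (\<integral>x. (norm (r x))\<^sup>2 \<partial>unit_leb) - (norm (osc_integral l g))\<^sup>2"
    unfolding norm_sq_diff_fourier_mode[OF r] c
    by (simp add: mult.commute[of "cnj _"] complex_norm_square[symmetric] del: times_complex.sel of_real_power)
  also have "\<dots> = (\<integral>x. (norm (g x))\<^sup>2 \<partial>unit_leb) - (\<Sum>h\<in>insert l H. (norm (osc_integral h g))\<^sup>2)"
    using insert by (simp add: r_def)
  finally show ?case .
qed

lemma Bessel_inequality:
  assumes "square_integrable_on_unit g" and "finite H"
  shows "(\<Sum>h\<in>H. (norm (osc_integral h g))\<^sup>2) \<le> (\<integral>x. (norm (g x))\<^sup>2 \<partial>unit_leb)"
  using Bessel_identity[OF assms]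
    Bochner_Integration.integral_nonneg[of unit_leb "\<lambda>x. (norm (g x - (\<Sum>h\<in>H. osc_integral h g * fourier_mode h x)))\<^sup>2"]
  by simp

section \<open>Weak derivatives\<close>

text \<open>
  This is \<open>H\<^sup>1\<close> regularity of \<open>g\<close> with a chosen representative \<open>g'\<close> of its derivative. Every step
    \<open>nth_deriv l f \<mapsto> nth_deriv (Suc l) f\<close> with \<open>l < s\<close> of a function in \<open>sobolev s\<close> is of this form, so the
    smooth steps and the last, almost-everywhere one are treated alike.
\<close>

definition has_weak_derivative :: "(real \<Rightarrow> complex) \<Rightarrow> (real \<Rightarrow> complex) \<Rightarrow> bool" where
  "has_weak_derivative g g' \<longleftrightarrow>
     absolutely_continuous_fun_on {0..1} g \<and> square_integrable_on_unit g' \<and>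
     (\<exists>N. negligible N \<and> (\<forall>x\<in>{0..1} - N. (g has_vector_derivative g' x) (at x within {0..1})))"

lemma has_weak_derivative_continuous:
  "has_weak_derivative g g' \<Longrightarrow> continuous_on {0..1} g"
  by (simp add: has_weak_derivative_def absolutely_continuous_imp_continuous_on)

lemma has_weak_derivative_smooth:
  assumes "\<And>x. x \<in> {0..1} \<Longrightarrow> (g has_vector_derivative g' x) (at x within {0..1})"
    and "continuous_on {0..1} g'"
  shows "has_weak_derivative g g'"
  unfolding has_weak_derivative_def
  using assms by (auto intro!: continuously_differentiable_imp_absolutely_continuous[OF assms]
      continuous_imp_square_integrable exI[of _ "{}"])

lemma has_weak_derivative_FTC:
  assumes g: "has_weak_derivative g g'" and y: "y \<in> {0..1}"
  shows "(\<integral>x. g' x * (if x \<le> y then 1 else 0) \<partial>unit_leb) = g y - g 0"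
proof -
  from g obtain N where ac: "absolutely_continuous_fun_on {0..1} g" and N: "negligible N"
    and d: "\<And>x. x \<in> {0..1} - N \<Longrightarrow> (g has_vector_derivative g' x) (at x within {0..1})"
    and sq: "square_integrable_on_unit g'"
    unfolding has_weak_derivative_def by blast
  have i: "integrable unit_leb (\<lambda>x. g' x * (if x \<le> y then 1 else 0))"
  proof (rule Bochner_Integration.integrable_bound)
    show "integrable unit_leb g'" by (rule square_integrable_imp_integrable[OF sq])
    then have "g' \<in> borel_measurable unit_leb" by simp
    moreover have "(\<lambda>x::real. if x \<le> y then 1 else (0::complex)) \<in> borel_measurable unit_leb"
      by (intro measurable_restrict_space1 measurable_completion) simp
    ultimately show "(\<lambda>x. g' x * (if x \<le> y then 1 else 0)) \<in> borel_measurable unit_leb"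
      by (rule borel_measurable_times)
  qed auto
  have "(g' has_integral g y - g 0) {0..y}"
  proof (rule absolutely_continuous_FTC[OF ac _ _ N])
    show "(g has_vector_derivative g' x) (at x within {0..y})" if "x \<in> {0..y} - N" for x
      using d[of x] that y by (auto intro: has_vector_derivative_within_subset)
  qed (use y in auto)
  then have "((\<lambda>x. if x \<in> {0..y} then g' x else 0) has_integral g y - g 0) {0..1}"
    using y by (subst has_integral_restrict) auto
  then have "((\<lambda>x. g' x * (if x \<le> y then 1 else 0)) has_integral g y - g 0) {0..1}"
    by (rule has_integral_eq[rotated]) auto
  with lebesgue_integral_eq_integral[OF i] show ?thesis
    by (simp add: integral_unique)
qed

lemma has_weak_derivative_by_parts:
  assumes g: "has_weak_derivative g g'"
    and \<phi>': "\<And>x. x \<in> {0..1} \<Longrightarrow> (\<phi> has_vector_derivative \<phi>' x) (at x within {0..1})"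
    and c: "continuous_on {0..1} \<phi>'"
  shows "(\<integral>x. g' x * \<phi> x \<partial>unit_leb) = g 1 * \<phi> 1 - g 0 * \<phi> 0 - (\<integral>x. g x * \<phi>' x \<partial>unit_leb)"
proof -
  from g obtain N where ac: "absolutely_continuous_fun_on {0..1} g" and N: "negligible N"
    and d: "\<And>x. x \<in> {0..1} - N \<Longrightarrow> (g has_vector_derivative g' x) (at x within {0..1})"
    and sq: "square_integrable_on_unit g'"
    unfolding has_weak_derivative_def by blast
  have "continuous_on {0..1} \<phi>"
    using \<phi>' continuous_on_eq_continuous_within has_vector_derivative_continuous by blast
  then have i1: "integrable unit_leb (\<lambda>x. g' x * \<phi> x)"
    by (intro square_integrable_mult sq continuous_imp_square_integrable)
  have i2: "integrable unit_leb (\<lambda>x. g x * \<phi>' x)"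
    by (intro square_integrable_mult continuous_imp_square_integrable c has_weak_derivative_continuous[OF g])
  have "(\<integral>x. g' x * \<phi> x \<partial>unit_leb) + (\<integral>x. g x * \<phi>' x \<partial>unit_leb)
     = (\<integral>x. g' x * \<phi> x + g x * \<phi>' x \<partial>unit_leb)"
    using i1 i2 by simp
  also have "\<dots> = integral {0..1} (\<lambda>x. g' x * \<phi> x + g x * \<phi>' x)"
    by (rule lebesgue_integral_eq_integral) (use i1 i2 in auto)
  also have "\<dots> = g 1 * \<phi> 1 - g 0 * \<phi> 0"
    by (rule integral_unique)
      (rule absolutely_continuous_integration_by_parts[OF ac zero_le_one N d \<phi>' c])
  finally show ?thesis by (simp add: algebra_simps)
qed

lemma osc_integral_weak_derivative:
  assumes g: "has_weak_derivative g g'" and per: "g 0 = g 1"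
  shows "osc_integral h g' = 2 * of_real pi * \<i> * of_int h * osc_integral h g"
proof -
  have "osc_integral h g' = - (\<integral>x. g x * (2 * of_real pi * \<i> * of_int (- h) * fourier_mode (- h) x) \<partial>unit_leb)"
    unfolding osc_integral_eq_fourier_coefficient
    by (subst has_weak_derivative_by_parts[OF g fourier_mode_has_vector_derivative])
      (auto intro!: continuous_intros simp: per)
  also have "(\<lambda>x. g x * (2 * of_real pi * \<i> * of_int (- h) * fourier_mode (- h) x))
    = (\<lambda>x. (2 * of_real pi * \<i> * of_int (- h)) * (g x * fourier_mode (- h) x))"
    by (auto simp: algebra_simps)
  finally show ?thesis by (simp add: osc_integral_eq_fourier_coefficient)
qed

section \<open>Pointwise convergence of Fourier series\<close>

text \<open>
  Except where \<open>x - y\<close> is an integer this is the periodic Bernoulli polynomial \<open>B\<^sub>1({x - y})\<close>. Its jump at \<open>y\<close>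
    reproduces the point value \<open>g y\<close> when it is integrated against \<open>g'\<close>.
\<close>

definition sawtooth :: "real \<Rightarrow> real \<Rightarrow> complex" where
  "sawtooth y x = of_real (x - y - 1 / 2) + (if x \<le> y then 1 else 0)"

lemma square_integrable_sawtooth: "square_integrable_on_unit (sawtooth y)"
proof -
  have "(\<lambda>x::real. if x \<le> y then 1 else (0::complex)) \<in> borel_measurable unit_leb"
    by (intro measurable_restrict_space1 measurable_completion) simp
  then have "square_integrable_on_unit (\<lambda>x::real. if x \<le> y then 1 else (0::complex))"
    unfolding square_integrable_on_unit_def
    by (auto intro!: Bochner_Integration.integrable_bound[OF integrable_const_unit[of "1::real"]])
  then have "square_integrable_on_unit (\<lambda>x. of_real (x - y - 1 / 2) - (-1) * (if x \<le> y then 1 else 0))"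
    by (intro square_integrable_diff square_integrable_cmult) (auto intro!: continuous_imp_square_integrable continuous_intros)
  then show ?thesis by (simp add: sawtooth_def[abs_def])
qed

lemma integral_weak_derivative_sawtooth:
  assumes g: "has_weak_derivative g g'" and per: "g 0 = g 1" and y: "y \<in> {0..1}"
  shows "(\<integral>x. g' x * sawtooth y x \<partial>unit_leb) = g y - (\<integral>x. g x \<partial>unit_leb)"
proof -
  have sq: "square_integrable_on_unit g'" using g by (simp add: has_weak_derivative_def)
  have i1: "integrable unit_leb (\<lambda>x. g' x * of_real (x - y - 1 / 2))"
    by (intro square_integrable_mult sq continuous_imp_square_integrable continuous_intros)
  have "integrable unit_leb (\<lambda>x. g' x * sawtooth y x - g' x * of_real (x - y - 1 / 2))"
    by (intro Bochner_Integration.integrable_diff i1 square_integrable_mult sq square_integrable_sawtooth)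
  then have i2: "integrable unit_leb (\<lambda>x. g' x * (if x \<le> y then 1 else 0))"
    by (simp add: sawtooth_def algebra_simps)
  have "(\<integral>x. g' x * sawtooth y x \<partial>unit_leb)
    = (\<integral>x. g' x * of_real (x - y - 1 / 2) \<partial>unit_leb) + (\<integral>x. g' x * (if x \<le> y then 1 else 0) \<partial>unit_leb)"
    unfolding sawtooth_def distrib_left using i1 i2 by (rule Bochner_Integration.integral_add)
  also have "(\<integral>x. g' x * of_real (x - y - 1 / 2) \<partial>unit_leb)
    = g 1 * of_real (1 - y - 1 / 2) - g 0 * of_real (0 - y - 1 / 2) - (\<integral>x. g x * 1 \<partial>unit_leb)"
  proof (rule has_weak_derivative_by_parts[OF g])
    show "((\<lambda>x. complex_of_real (x - y - 1 / 2)) has_vector_derivative 1) (at x within {0..1})" for x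
      by (auto intro!: derivative_eq_intros simp: has_vector_derivative_def scaleR_conv_of_real)
  qed auto
  also have "(\<integral>x. g' x * (if x \<le> y then 1 else 0) \<partial>unit_leb) = g y - g 0"
    by (rule has_weak_derivative_FTC[OF g y])
  finally show ?thesis by (simp add: per algebra_simps)
qed

text \<open>
  Instead of integrating, apply the reproducing property of the sawtooth to the exponential itself.
\<close>

lemma osc_integral_sawtooth:
  assumes "h \<noteq> 0" and y: "y \<in> {0..1}"
  shows "osc_integral h (sawtooth y) = - fourier_mode (- h) y / (2 * of_real pi * \<i> * of_int h)"
proof -
  have "(\<integral>x. 2 * of_real pi * \<i> * of_int (- h) * fourier_mode (- h) x * sawtooth y x \<partial>unit_leb)
    = fourier_mode (- h) y - (\<integral>x. fourier_mode (- h) x \<partial>unit_leb)"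
    by (rule integral_weak_derivative_sawtooth[OF has_weak_derivative_smooth _ y])
      (auto intro!: fourier_mode_has_vector_derivative continuous_intros simp del: of_int_minus)
  also have "(\<lambda>x. 2 * of_real pi * \<i> * of_int (- h) * fourier_mode (- h) x * sawtooth y x)
    = (\<lambda>x. (2 * of_real pi * \<i> * of_int (- h)) * (sawtooth y x * fourier_mode (- h) x))"
    by (auto simp: algebra_simps)
  finally have "(2 * of_real pi * \<i> * of_int (- h)) * osc_integral h (sawtooth y) = fourier_mode (- h) y"
    using assms by (simp add: integral_fourier_mode osc_integral_eq_fourier_coefficient)
  then have "osc_integral h (sawtooth y) = fourier_mode (- h) y / (2 * of_real pi * \<i> * of_int (- h))"
    using assms by (metis nonzero_mult_div_cancel_left mult_eq_0_iff of_int_eq_0_iff neg_equal_0_iff_equal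
        complex_i_not_zero of_real_eq_0_iff pi_neq_zero zero_neq_numeral)
  then show ?thesis by simp
qed

lemma norm_sawtooth:
  assumes y: "y \<in> {0..1}"
  shows "(\<integral>x. (norm (sawtooth y x))\<^sup>2 \<partial>unit_leb) = 1 / 12"
proof -
  have i: "integrable unit_leb (\<lambda>x. (norm (sawtooth y x))\<^sup>2)"
    using square_integrable_sawtooth by (simp add: square_integrable_on_unit_def)
  \<comment> \<open>Expanding the square leaves a polynomial on the whole interval plus one on \<open>{0..y}\<close>.\<close>
  have eq: "(norm (sawtooth y x))\<^sup>2 = (x - y - 1 / 2)\<^sup>2 + (if x \<in> {0..y} then 2 * x - 2 * y else 0)"
    if "x \<in> {0..1}" for x
  proof -
    have "sawtooth y x = of_real (x - y - 1 / 2 + (if x \<le> y then 1 else 0))"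
      by (simp add: sawtooth_def)
    then show ?thesis using that by (auto simp: norm_of_real power2_eq_square algebra_simps simp del: of_real_add of_real_diff)
  qed
  have "((\<lambda>x. (x - y - 1 / 2)\<^sup>2) has_integral (1 - y - 1 / 2) ^ 3 / 3 - (0 - y - 1 / 2) ^ 3 / 3) {0..1}"
    by (rule fundamental_theorem_of_calculus)
      (auto simp: has_real_derivative_iff_has_vector_derivative[symmetric] intro!: derivative_eq_intros)
  moreover have "((\<lambda>x. 2 * x - 2 * y) has_integral (y\<^sup>2 - 2 * y * y) - (0\<^sup>2 - 2 * y * 0)) {0..y}"
    using y by (intro fundamental_theorem_of_calculus)
      (auto simp: has_real_derivative_iff_has_vector_derivative[symmetric] intro!: derivative_eq_intros)
  then have "((\<lambda>x. if x \<in> {0..y} then 2 * x - 2 * y else 0) has_integral (y\<^sup>2 - 2 * y * y) - (0\<^sup>2 - 2 * y * 0)) {0..1}"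
    using y by (subst has_integral_restrict) auto
  ultimately have "((\<lambda>x. (x - y - 1 / 2)\<^sup>2 + (if x \<in> {0..y} then 2 * x - 2 * y else 0)) has_integral
     ((1 - y - 1 / 2) ^ 3 / 3 - (0 - y - 1 / 2) ^ 3 / 3) + ((y\<^sup>2 - 2 * y * y) - (0\<^sup>2 - 2 * y * 0))) {0..1}"
    by (rule has_integral_add)
  moreover have "((1 - y - 1 / 2) ^ 3 / 3 - (0 - y - 1 / 2) ^ 3 / 3) + ((y\<^sup>2 - 2 * y * y) - (0\<^sup>2 - 2 * y * 0)) = 1 / 12"
    by (simp add: power2_eq_square power3_eq_cube field_simps)
  ultimately have "((\<lambda>x. (norm (sawtooth y x))\<^sup>2) has_integral 1 / 12) {0..1}"
    using eq by (metis (no_types, lifting) has_integral_cong)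
  with lebesgue_integral_eq_integral[OF i] show ?thesis
    by (simp add: integral_unique)
qed

lemma sum_symmetric_interval:
  fixes F :: "int \<Rightarrow> 'a::comm_monoid_add"
  shows "(\<Sum>h\<in>{- int M..int M} - {0}. F h) = (\<Sum>n<M. F (int (Suc n)) + F (- int (Suc n)))"
proof (induction M)
  case 0
  then show ?case by simp
next
  case (Suc M)
  have "{- int (Suc M)..int (Suc M)} - {0}
    = insert (int (Suc M)) (insert (- int (Suc M)) ({- int M..int M} - {0}))" by auto
  then show ?case using Suc by (simp add: add_ac)
qed

text \<open>
  The value \<open>\<pi>\<^sup>2 / 6\<close> of the Basel series says that the squared Fourier coefficients of the sawtooth add up
    to \<open>1 / 12\<close>, which is its squared norm. This is Parseval's identity for this one function and replaces
    a completeness theorem for the trigonometric system.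
\<close>

lemma sawtooth_tail_tendsto_0:
  "(\<lambda>M. 1 / 12 - (\<Sum>h\<in>{- int M..int M} - {0}. 1 / (2 * pi * of_int h)\<^sup>2)) \<longlonglongrightarrow> 0"
proof -
  have "(\<lambda>M. \<Sum>n<M. 1 / (real n + 1)\<^sup>2) \<longlonglongrightarrow> pi\<^sup>2 / 6"
    using inverse_squares_sums by (simp add: sums_def add.commute)
  then have "(\<lambda>M. 1 / 12 - (1 / (2 * pi\<^sup>2)) * (\<Sum>n<M. 1 / (real n + 1)\<^sup>2)) \<longlonglongrightarrow> 1 / 12 - (1 / (2 * pi\<^sup>2)) * (pi\<^sup>2 / 6)"
    by (intro tendsto_intros)
  moreover have "(\<Sum>h\<in>{- int M..int M} - {0}. 1 / (2 * pi * of_int h)\<^sup>2)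
      = (1 / (2 * pi\<^sup>2)) * (\<Sum>n<M. 1 / (real n + 1)\<^sup>2)" for M
    unfolding sum_symmetric_interval sum_distrib_left
    by (rule sum.cong) (auto simp: power2_eq_square divide_simps, auto simp: algebra_simps)
  ultimately show ?thesis by simp
qed

text \<open>
  The partial sum at \<open>y\<close> is the reproducing formula for \<open>g y\<close> with the sawtooth replaced by its
    trigonometric partial sum. By Cauchy--Schwarz the difference is at most \<open>\<parallel>g'\<parallel>\<close> times the \<open>L\<^sub>2\<close> distance of
    the sawtooth from that partial sum, which tends to zero.
\<close>

theorem Fourier_series_pointwise:
  assumes g: "has_weak_derivative g g'" and per: "g 0 = g 1" and y: "y \<in> {0..1}"
  shows "(\<lambda>M. \<Sum>h\<in>{- int M..int M}. osc_integral h g * fourier_mode h y) \<longlonglongrightarrow> g y"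
proof -
  have sq: "square_integrable_on_unit g'" using g by (simp add: has_weak_derivative_def)
  define T where "T M = 1 / 12 - (\<Sum>h\<in>{- int M..int M} - {0}. 1 / (2 * pi * of_int h)\<^sup>2)" for M
  have bound: "norm ((\<Sum>h\<in>{- int M..int M}. osc_integral h g * fourier_mode h y) - g y)
    \<le> sqrt (\<integral>x. (norm (g' x))\<^sup>2 \<partial>unit_leb) * sqrt (T M)" for M
  proof -
    define H where "H = {- int M..int M} - {0}"
    have H: "finite H" "0 \<notin> H" by (auto simp: H_def)
    define p where "p x = (\<Sum>h\<in>H. osc_integral h (sawtooth y) * fourier_mode h x)" for x
    have p: "square_integrable_on_unit p"
      unfolding p_def by (intro square_integrable_sum square_integrable_cmult square_integrable_fourier_mode H)
    have "(\<integral>x. (norm (sawtooth y x - p x))\<^sup>2 \<partial>unit_leb)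
      = 1 / 12 - (\<Sum>h\<in>H. (norm (osc_integral h (sawtooth y)))\<^sup>2)"
      unfolding p_def by (simp add: Bessel_identity[OF square_integrable_sawtooth H(1)] norm_sawtooth[OF y])
    also have "(\<Sum>h\<in>H. (norm (osc_integral h (sawtooth y)))\<^sup>2) = (\<Sum>h\<in>H. 1 / (2 * pi * of_int h)\<^sup>2)"
      using H(2) by (intro sum.cong refl, subst osc_integral_sawtooth[OF _ y])
        (auto simp: norm_divide norm_mult power_divide power_mult_distrib)
    finally have T: "(\<integral>x. (norm (sawtooth y x - p x))\<^sup>2 \<partial>unit_leb) = T M"
      by (simp add: T_def H_def)
    have coeff: "osc_integral h (sawtooth y) * osc_integral (- h) g' = osc_integral (- h) g * fourier_mode (- h) y"
      if "h \<in> H" for h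
      using that H(2) by (subst osc_integral_sawtooth[OF _ y]) (auto simp: osc_integral_weak_derivative[OF g per])
    have "(\<integral>x. g' x * p x \<partial>unit_leb)
        = (\<integral>x. (\<Sum>h\<in>H. osc_integral h (sawtooth y) * (g' x * fourier_mode h x)) \<partial>unit_leb)"
      by (simp add: p_def sum_distrib_left mult_ac)
    also have "\<dots> = (\<Sum>h\<in>H. osc_integral h (sawtooth y) * osc_integral (- h) g')"
      by (subst Bochner_Integration.integral_sum)
        (auto simp: osc_integral_eq_fourier_coefficient intro!: integrable_mult_right square_integrable_mult sq square_integrable_fourier_mode)
    also have "\<dots> = (\<Sum>h\<in>H. osc_integral (- h) g * fourier_mode (- h) y)"
      by (intro sum.cong refl coeff)
    also have "\<dots> = (\<Sum>h\<in>H. osc_integral h g * fourier_mode h y)"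
      by (rule sum.reindex_bij_witness[of _ uminus uminus]) (auto simp: H_def)
    finally have gp: "(\<integral>x. g' x * p x \<partial>unit_leb) = (\<Sum>h\<in>H. osc_integral h g * fourier_mode h y)" .
    have "{- int M..int M} = insert 0 H" by (auto simp: H_def)
    then have "(\<Sum>h\<in>{- int M..int M}. osc_integral h g * fourier_mode h y)
      = (\<integral>x. g x \<partial>unit_leb) + (\<Sum>h\<in>H. osc_integral h g * fourier_mode h y)"
      using H by (simp add: osc_integral_eq_fourier_coefficient)
    also have "\<dots> - g y = - ((\<integral>x. g' x * sawtooth y x \<partial>unit_leb) - (\<integral>x. g' x * p x \<partial>unit_leb))"
      by (simp add: gp integral_weak_derivative_sawtooth[OF g per y])
    also have "\<dots> = - (\<integral>x. g' x * (sawtooth y x - p x) \<partial>unit_leb)"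
      unfolding right_diff_distrib
      by (subst Bochner_Integration.integral_diff)
        (auto intro!: square_integrable_mult sq square_integrable_sawtooth p)
    also have "norm \<dots> \<le> sqrt (\<integral>x. (norm (g' x))\<^sup>2 \<partial>unit_leb) * sqrt (\<integral>x. (norm (sawtooth y x - p x))\<^sup>2 \<partial>unit_leb)"
      unfolding norm_minus_cancel
      by (intro Cauchy_Schwarz_unit sq square_integrable_diff square_integrable_sawtooth p)
    finally show ?thesis by (simp add: T)
  qed
  have "(\<lambda>M. sqrt (\<integral>x. (norm (g' x))\<^sup>2 \<partial>unit_leb) * sqrt (T M)) \<longlonglongrightarrow> sqrt (\<integral>x. (norm (g' x))\<^sup>2 \<partial>unit_leb) * sqrt 0"
    using sawtooth_tail_tendsto_0 unfolding T_def by (intro tendsto_intros)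
  then have "(\<lambda>M. sqrt (\<integral>x. (norm (g' x))\<^sup>2 \<partial>unit_leb) * sqrt (T M)) \<longlonglongrightarrow> 0" by simp
  then have "(\<lambda>M. (\<Sum>h\<in>{- int M..int M}. osc_integral h g * fourier_mode h y) - g y) \<longlonglongrightarrow> 0"
    by (rule Lim_null_comparison[rotated]) (use bound in \<open>auto intro: always_eventually\<close>)
  then show ?thesis by (simp add: LIM_zero_iff)
qed

section \<open>Fourier coefficients of Sobolev functions\<close>

lemma AE_unit_leb_negligible:
  assumes "AE x in unit_leb. P x"
  shows "\<exists>N. negligible N \<and> (\<forall>x\<in>{0..1} - N. P x)"
proof -
  have "AE x in lebesgue. x \<in> {0..1::real} \<longrightarrow> P x"
    using assms by (subst (asm) AE_restrict_space_iff) auto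
  then obtain N where "N \<in> null_sets lebesgue" "{x \<in> space lebesgue. \<not> (x \<in> {0..1} \<longrightarrow> P x)} \<subseteq> N"
    unfolding eventually_ae_filter by blast
  then show ?thesis by (intro exI[of _ N]) (auto simp: negligible_iff_null_sets)
qed

lemma sobolev_has_weak_derivative:
  assumes f: "f \<in> sobolev s" and l: "l < s"
  shows "has_weak_derivative (nth_deriv l f) (nth_deriv (Suc l) f)"
proof (cases "l < s - 1")
  case True
  have diff: "nth_deriv m f differentiable (at x within {0..1})" if "m < s - 1" "x \<in> {0..1}" for m x
    using f that by (auto simp: sobolev_def)
  have "continuous_on {0..1} (nth_deriv (Suc l) f)"
  proof (cases "Suc l < s - 1")
    case True
    then show ?thesis unfolding continuous_on_eq_continuous_within
      by (intro ballI differentiable_imp_continuous_within diff)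
  next
    case False
    then have "Suc l = s - 1" using \<open>l < s - 1\<close> by simp
    then show ?thesis using f by (simp only: sobolev_def mem_Collect_eq absolutely_continuous_imp_continuous_on)
  qed
  moreover have "(nth_deriv l f has_vector_derivative nth_deriv (Suc l) f x) (at x within {0..1})"
    if "x \<in> {0..1}" for x
    using diff[OF True that] by (simp add: vector_derivative_works)
  ultimately show ?thesis by (intro has_weak_derivative_smooth)
next
  case False
  then have l': "l = s - 1" and s: "Suc l = s" using l by auto
  have "AE x in unit_leb. nth_deriv l f differentiable (at x within {0..1})"
    using f l' by (simp add: sobolev_def)
  from AE_unit_leb_negligible[OF this]
  obtain N where N: "negligible N" "\<forall>x\<in>{0..1} - N. nth_deriv l f differentiable (at x within {0..1})"
    by blast
  then have "\<forall>x\<in>{0..1} - N. (nth_deriv l f has_vector_derivative nth_deriv (Suc l) f x) (at x within {0..1})"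
    by (simp add: vector_derivative_works)
  moreover have "absolutely_continuous_fun_on {0..1} (nth_deriv l f)" "square_integrable_on_unit (nth_deriv (Suc l) f)"
    using f l' unfolding s by (simp_all add: sobolev_def)
  ultimately show ?thesis using N(1) unfolding has_weak_derivative_def by blast
qed

lemma osc_integral_nth_deriv:
  assumes f: "f \<in> periodic_sobolev s" and "l \<le> s"
  shows "osc_integral h (nth_deriv l f) = (2 * of_real pi * \<i> * of_int h) ^ l * osc_integral h f"
  using \<open>l \<le> s\<close>
proof (induction l)
  case 0
  then show ?case by simp
next
  case (Suc l)
  have "osc_integral h (nth_deriv (Suc l) f) = 2 * of_real pi * \<i> * of_int h * osc_integral h (nth_deriv l f)"
    by (rule osc_integral_weak_derivative[OF sobolev_has_weak_derivative[of f s]])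
      (use f Suc in \<open>auto simp: periodic_sobolev_def\<close>)
  then show ?case using Suc by (simp del: nth_deriv.simps add: mult_ac)
qed

lemma sobolev_norm_eq:
  "sobolev_norm s f = sqrt ((\<Sum>l<s. (norm (\<integral>x. nth_deriv l f x \<partial>unit_leb))\<^sup>2)
     + (\<integral>x. (norm (nth_deriv s f x))\<^sup>2 \<partial>unit_leb))"
proof -
  have "(\<integral>x. nth_deriv s f x * cnj (nth_deriv s f x) \<partial>unit_leb)
    = of_real (\<integral>x. (norm (nth_deriv s f x))\<^sup>2 \<partial>unit_leb)"
    unfolding complex_norm_square[symmetric] by (rule integral_complex_of_real)
  moreover have "(\<Sum>l<s. (\<integral>x. nth_deriv l f x \<partial>unit_leb) * (\<integral>x. cnj (nth_deriv l f x) \<partial>unit_leb))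
    = of_real (\<Sum>l<s. (norm (\<integral>x. nth_deriv l f x \<partial>unit_leb))\<^sup>2)"
    by (simp only: Bochner_Integration.integral_cnj complex_norm_square of_real_sum)
  ultimately have "sobolev_inner s f f = of_real ((\<Sum>l<s. (norm (\<integral>x. nth_deriv l f x \<partial>unit_leb))\<^sup>2)
     + (\<integral>x. (norm (nth_deriv s f x))\<^sup>2 \<partial>unit_leb))"
    unfolding sobolev_inner_def by simp
  then show ?thesis by (simp add: sobolev_norm_def del: of_real_add of_real_sum)
qed

lemma sobolev_norm_nonneg: "0 \<le> sobolev_norm s f"
  by (simp add: sobolev_norm_eq sum_nonneg)

lemma integral_highest_deriv_le_sobolev_norm:
  "(\<integral>x. (norm (nth_deriv s f x))\<^sup>2 \<partial>unit_leb) \<le> (sobolev_norm s f)\<^sup>2"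
  by (simp add: sobolev_norm_eq sum_nonneg)

text \<open>
  This is Bessel's inequality for the highest derivative, whose coefficient at \<open>h\<close> is that of \<open>f\<close> times
    \<open>(2 \<pi> \<i> h)\<^sup>s\<close>.
\<close>

lemma Fourier_coefficients_sobolev_bound:
  assumes f: "f \<in> periodic_sobolev s" "sobolev_norm s f \<le> 1" and "finite H"
  shows "(\<Sum>h\<in>H. ((2 * pi * \<bar>of_int h\<bar>) ^ s * norm (osc_integral h f))\<^sup>2) \<le> 1"
proof -
  have "(\<Sum>h\<in>H. ((2 * pi * \<bar>of_int h\<bar>) ^ s * norm (osc_integral h f))\<^sup>2)
    = (\<Sum>h\<in>H. (norm (osc_integral h (nth_deriv s f)))\<^sup>2)"
    by (simp add: osc_integral_nth_deriv[OF f(1) order_refl] norm_mult norm_power)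
  also have "\<dots> \<le> (\<integral>x. (norm (nth_deriv s f x))\<^sup>2 \<partial>unit_leb)"
    by (rule Bessel_inequality) (use f \<open>finite H\<close> in \<open>auto simp: periodic_sobolev_def sobolev_def\<close>)
  also have "\<dots> \<le> (sobolev_norm s f)\<^sup>2"
    by (rule integral_highest_deriv_le_sobolev_norm)
  also have "\<dots> \<le> 1"
  proof (rule power_le_one)
    show "0 \<le> sobolev_norm s f"
      using sobolev_norm_nonneg .
  qed (rule f(2))
  finally show ?thesis .
qed

section \<open>Inverse powers over a residue class\<close>

text \<open>
  The term \<open>m = -1\<close> contributes 1. All others are dominated by a telescoping series. The bound 2 leaves
    some room, but not enough to replace both \<open>|2m + 1|\<close> and \<open>|2m - 1|\<close> by the smaller of the two, since the
    sum would then be \<open>\<pi>\<^sup>2 / 4 > 2\<close>.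
\<close>

lemma sum_inverse_odd_squares_le:
  assumes "finite F" "0 \<notin> F"
  shows "(\<Sum>m\<in>F. 1 / (2 * real_of_int m + 1)\<^sup>2) \<le> 2"
proof -
  define L where "L = nat (Max (insert 0 (abs ` F)))"
  have "\<bar>m\<bar> \<le> Max (insert 0 (abs ` F))" if "m \<in> F" for m
    using assms(1) that by (intro Max_ge) auto
  then have "F \<subseteq> {- int L..int L} - {0}"
    using assms(2) by (fastforce simp: L_def)
  \<comment> \<open>The enlarged interval makes the sum nonempty, so that the bound \<open>2 - 1 / (2 (L + 1))\<close> telescopes from \<open>L = 0\<close>.\<close>
  then have "F \<subseteq> {- int (Suc L)..int (Suc L)} - {0}" by fastforce
  then have "(\<Sum>m\<in>F. 1 / (2 * real_of_int m + 1)\<^sup>2)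
      \<le> (\<Sum>m\<in>{- int (Suc L)..int (Suc L)} - {0}. 1 / (2 * real_of_int m + 1)\<^sup>2)"
    by (intro sum_mono2) auto
  also have "\<dots> = (\<Sum>n<Suc L. 1 / (2 * real n + 3)\<^sup>2 + 1 / (2 * real n + 1)\<^sup>2)"
    unfolding sum_symmetric_interval
    by (intro sum.cong refl) (simp add: algebra_simps power2_eq_square)
  also have "\<dots> \<le> 2 - 1 / (2 * (real L + 1))"
  proof (induction L)
    case 0
    then show ?case by (simp add: power2_eq_square)
  next
    case (Suc L)
    define x where "x = real L + 1"
    have x: "x \<ge> 1" by (simp add: x_def)
    have "1 / (2 * x + 3)\<^sup>2 + 1 / (2 * x + 1)\<^sup>2 \<le> 1 / (2 * x + 1)\<^sup>2 + 1 / (2 * x + 1)\<^sup>2"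
      using x by (intro add_mono divide_left_mono power_mono) auto
    also have "\<dots> = 2 / (2 * x + 1)\<^sup>2" by simp
    also have "\<dots> \<le> 2 / (4 * x * (x + 1))"
    proof (rule divide_left_mono)
      show "4 * x * (x + 1) \<le> (2 * x + 1)\<^sup>2" by (simp add: power2_eq_square algebra_simps)
      show "0 < (2 * x + 1)\<^sup>2 * (4 * x * (x + 1))"
        using x by (intro mult_pos_pos zero_less_power) auto
    qed simp
    also have "\<dots> = 1 / (2 * x) - 1 / (2 * (x + 1))"
      using x by (simp add: divide_simps) 
    finally have step: "1 / (2 * x + 3)\<^sup>2 + 1 / (2 * x + 1)\<^sup>2 \<le> 1 / (2 * x) - 1 / (2 * (x + 1))" .
    show ?case
      unfolding sum.lessThan_Suc[of _ "Suc L"] using Suc step by (simp add: x_def add_ac)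
  qed
  also have "\<dots> \<le> 2" by simp
  finally show ?thesis .
qed

text \<open>
  After subtracting, the claim becomes \<open>(m - 1) (n - 2k) \<ge> 0\<close> for positive \<open>m\<close> and
    \<open>(1 - m) (n - 2k) \<ge> 0\<close> for negative \<open>m\<close>. Both hold with equality for all \<open>m\<close> if \<open>n = 2k\<close>, which explains the
    constant 3.
\<close>

lemma residue_class_lower_bound:
  fixes k m :: int and n :: nat
  assumes "m \<noteq> 0" "0 \<le> k" "2 * k \<le> int n"
  shows "\<bar>2 * m + 1\<bar> * (int n + k) \<le> 3 * \<bar>k + m * int n\<bar>"
proof (cases "m > 0")
  case True
  have "0 \<le> (m - 1) * (int n - 2 * k)" using True assms by (intro mult_nonneg_nonneg) auto
  then have "(2 * m + 1) * (int n + k) \<le> 3 * (k + m * int n)" by (simp add: algebra_simps)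
  then show ?thesis using True by (smt (verit))
next
  case False
  then have "m \<le> -1" using assms by auto
  then have "0 \<le> (- m + 1) * (int n - 2 * k)" using assms by (intro mult_nonneg_nonneg) auto
  then have "- (2 * m + 1) * (int n + k) \<le> 3 * - (k + m * int n)" by (simp add: algebra_simps)
  then show ?thesis using \<open>m \<le> -1\<close> by (smt (verit))
qed

lemma sum_residue_class_le_nonneg:
  fixes k :: int and n :: nat
  assumes F: "finite F" "0 \<notin> F" and k: "0 \<le> k" "2 * k \<le> int n" and n: "n \<ge> 1" and s: "s \<ge> 1"
  shows "(\<Sum>m\<in>F. (1 / \<bar>real_of_int (k + m * int n)\<bar> ^ s)\<^sup>2) \<le> 2 * ((3 / (real n + real_of_int k)) ^ s)\<^sup>2"
proof -
  define N where "N = real n + real_of_int k"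
  have N: "N > 0" using n k by (simp add: N_def)
  have "(1 / \<bar>real_of_int (k + m * int n)\<bar> ^ s)\<^sup>2 \<le> ((3 / N) ^ s)\<^sup>2 * (1 / (2 * real_of_int m + 1)\<^sup>2)"
    if "m \<in> F" for m
  proof -
    have "m \<noteq> 0" using that F by auto
    define q where "q = \<bar>2 * real_of_int m + 1\<bar>"
    have "\<bar>2 * m + 1\<bar> \<ge> 1" by presburger
    then have "real_of_int \<bar>2 * m + 1\<bar> \<ge> 1" by linarith
    then have q1: "q \<ge> 1" by (simp add: q_def)
    have "real_of_int (\<bar>2 * m + 1\<bar> * (int n + k)) \<le> real_of_int (3 * \<bar>k + m * int n\<bar>)"
      using residue_class_lower_bound[OF \<open>m \<noteq> 0\<close> k] by (simp only: of_int_le_iff)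
    then have le: "q * N \<le> 3 * \<bar>real_of_int (k + m * int n)\<bar>"
      by (simp add: q_def N_def)
    have pos: "q * N > 0" using q1 N by simp
    have "\<bar>real_of_int (k + m * int n)\<bar> > 0"
      using less_le_trans[OF pos le] by (simp only: zero_less_mult_iff) auto
    with pos le have "1 / \<bar>real_of_int (k + m * int n)\<bar> \<le> 3 / (q * N)"
      by (simp add: pos_divide_le_eq pos_le_divide_eq mult.commute del: of_int_add of_int_mult)
    then have "(1 / \<bar>real_of_int (k + m * int n)\<bar>) ^ s \<le> (3 / (q * N)) ^ s"
      by (rule power_mono) simp
    then have "((1 / \<bar>real_of_int (k + m * int n)\<bar>) ^ s)\<^sup>2 \<le> ((3 / (q * N)) ^ s)\<^sup>2"
      by (rule power_mono) simp
    also have "((3 / (q * N)) ^ s)\<^sup>2 = ((3 / N) ^ s)\<^sup>2 * ((1 / q) ^ s)\<^sup>2"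
      by (simp add: power_divide power_mult_distrib)
    also have "\<dots> \<le> ((3 / N) ^ s)\<^sup>2 * (1 / q)\<^sup>2"
    proof (intro mult_left_mono power_mono)
      show "(1 / q) ^ s \<le> 1 / q"
        using power_decreasing[of 1 s "1 / q"] s q1 by simp
    qed (use q1 in auto)
    finally show ?thesis by (simp add: q_def power_divide)
  qed
  then have "(\<Sum>m\<in>F. (1 / \<bar>real_of_int (k + m * int n)\<bar> ^ s)\<^sup>2)
    \<le> (\<Sum>m\<in>F. ((3 / N) ^ s)\<^sup>2 * (1 / (2 * real_of_int m + 1)\<^sup>2))"
    by (rule sum_mono)
  also have "\<dots> = ((3 / N) ^ s)\<^sup>2 * (\<Sum>m\<in>F. 1 / (2 * real_of_int m + 1)\<^sup>2)"
    by (rule sum_distrib_left[symmetric])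
  also have "\<dots> \<le> ((3 / N) ^ s)\<^sup>2 * 2"
    by (intro mult_left_mono sum_inverse_odd_squares_le F) auto
  finally show ?thesis by (simp add: N_def mult.commute)
qed

text \<open>
  Changing the signs of \<open>k\<close> and of all \<open>m\<close> reduces negative \<open>k\<close> to the previous case.
\<close>

lemma sum_residue_class_le:
  fixes k :: int and n :: nat
  assumes F: "finite F" "0 \<notin> F" and k: "2 * \<bar>k\<bar> \<le> int n" and n: "n \<ge> 1" and s: "s \<ge> 1"
  shows "(\<Sum>m\<in>F. (1 / \<bar>real_of_int (k + m * int n)\<bar> ^ s)\<^sup>2) \<le> 2 * ((3 / (real n + \<bar>real_of_int k\<bar>)) ^ s)\<^sup>2"
proof (cases "k \<ge> 0")
  case True
  then show ?thesis using sum_residue_class_le_nonneg[OF F True _ n s] k by simp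
next
  case False
  have "(\<Sum>m\<in>F. (1 / \<bar>real_of_int (k + m * int n)\<bar> ^ s)\<^sup>2)
    = (\<Sum>m\<in>uminus ` F. (1 / \<bar>real_of_int (- k + m * int n)\<bar> ^ s)\<^sup>2)"
    by (subst sum.reindex) (auto simp: inj_on_def abs_minus_commute)
  also have "\<dots> \<le> 2 * ((3 / (real n + real_of_int (- k))) ^ s)\<^sup>2"
    using F k False by (intro sum_residue_class_le_nonneg n s) auto
  finally show ?thesis using False by simp
qed

section \<open>The error of the rectangle rule\<close>

lemma average_fourier_mode:
  assumes n: "n \<ge> 1"
  shows "(\<Sum>j<n. fourier_mode l (real j / real n)) / of_nat n = (if int n dvd l then 1 else 0)"
proof -
  define w where "w = cis (2 * pi * of_int l / real n)"
  have w: "fourier_mode l (real j / real n) = w ^ j" for j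
  proof -
    have "w ^ j = cis (real j * (2 * pi * of_int l / real n))"
      unfolding w_def by (rule Complex.DeMoivre)
    then show ?thesis by (simp add: fourier_mode_def mult_ac)
  qed
  have wn: "w ^ n = 1"
    using n cis_multiple_2pi[of "of_int l"] by (simp add: w_def Complex.DeMoivre)
  show ?thesis
  proof (cases "int n dvd l")
    case True
    then obtain m where "l = int n * m" by (auto elim: dvdE)
    then have "w = 1" using n cis_multiple_2pi[of "of_int m"] by (simp add: w_def mult.assoc)
    then show ?thesis using True n by (simp add: w)
  next
    case False
    have "w \<noteq> 1"
    proof
      assume "w = 1"
      then have "cos (2 * pi * of_int l / real n) = 1"
        by (simp add: w_def complex_eq_iff)
      then obtain m :: int where "2 * pi * of_int l / real n = of_int m * 2 * pi"
        unfolding cos_one_2pi_int by blast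
      then have "real_of_int l = real_of_int (int n * m)"
        using n by (simp add: field_simps)
      then have "l = int n * m" by (simp only: of_int_eq_iff)
      then show False using False by simp
    qed
    then show ?thesis using False wn by (simp add: w geometric_sum)
  qed
qed

text \<open>
  The equal-weight rule at the nodes \<open>j / n\<close> for the integrand \<open>f(x) exp(-2 \<pi> \<i> k x)\<close>. The derivative of order
    zero is spelled out to match the form of an element of \<open>algorithms s n\<close>.
\<close>

definition modulated_rectangle_rule :: "int \<Rightarrow> nat \<Rightarrow> (real \<Rightarrow> complex) \<Rightarrow> complex" where
  "modulated_rectangle_rule k n f =
     (\<Sum>j<n. fourier_mode (- k) (real j / real n) / of_nat n * nth_deriv 0 f (real j / real n))"

lemma modulated_rectangle_rule_in_algorithms:
  assumes "s \<ge> 1"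
  shows "modulated_rectangle_rule k n \<in> algorithms s n"
proof -
  have "modulated_rectangle_rule k n =
     (\<lambda>f. \<Sum>j<n. fourier_mode (- k) (real j / real n) / of_nat n * nth_deriv 0 f (real j / real n))"
    by (auto simp: modulated_rectangle_rule_def)
  then show ?thesis unfolding algorithms_def mem_Collect_eq
    using assms by (intro exI[of _ "\<lambda>j. fourier_mode (- k) (real j / real n) / of_nat n"]
        exI[of _ "\<lambda>_. 0"] exI[of _ "\<lambda>j. real j / real n"]) auto
qed

text \<open>
  The rule cannot distinguish frequencies that agree modulo \<open>n\<close>: it annihilates every mode whose
    frequency is not congruent to \<open>k\<close>, and sends the others to 1. Its value is therefore the sum of the
    Fourier coefficients of \<open>f\<close> over the residue class of \<open>k\<close>.
\<close>

lemma modulated_rectangle_rule_aliasing: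
  assumes f: "f \<in> periodic_sobolev s" and s: "s \<ge> 1" and n: "n \<ge> 1"
  shows "(\<lambda>M. \<Sum>h\<in>{h \<in> {- int M..int M}. int n dvd h - k}. osc_integral h f)
    \<longlonglongrightarrow> modulated_rectangle_rule k n f"
proof -
  have wd: "has_weak_derivative f (nth_deriv 1 f)" and per: "f 0 = f 1"
    using sobolev_has_weak_derivative[of f s 0] f s by (force simp: periodic_sobolev_def)+
  have "(\<lambda>M. \<Sum>j<n. fourier_mode (- k) (real j / real n) / of_nat n *
       (\<Sum>h\<in>{- int M..int M}. osc_integral h f * fourier_mode h (real j / real n)))
    \<longlonglongrightarrow> (\<Sum>j<n. fourier_mode (- k) (real j / real n) / of_nat n * f (real j / real n))"
    by (intro tendsto_sum tendsto_mult tendsto_const Fourier_series_pointwise[OF wd per]) auto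
  moreover have "(\<Sum>j<n. fourier_mode (- k) (real j / real n) / of_nat n *
       (\<Sum>h\<in>{- int M..int M}. osc_integral h f * fourier_mode h (real j / real n)))
    = (\<Sum>h\<in>{h \<in> {- int M..int M}. int n dvd h - k}. osc_integral h f)" for M
  proof -
    have "(\<Sum>j<n. fourier_mode (- k) (real j / real n) / of_nat n *
       (\<Sum>h\<in>{- int M..int M}. osc_integral h f * fourier_mode h (real j / real n)))
      = (\<Sum>h\<in>{- int M..int M}. \<Sum>j<n. osc_integral h f * (fourier_mode h (real j / real n) * fourier_mode (- k) (real j / real n) / of_nat n))"
      by (subst sum.swap) (simp add: sum_distrib_left mult_ac)
    also have "\<dots> = (\<Sum>h\<in>{- int M..int M}. osc_integral h f * ((\<Sum>j<n. fourier_mode (h - k) (real j / real n)) / of_nat n))"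
      by (simp add: fourier_mode_mult sum_distrib_left sum_divide_distrib)
    also have "\<dots> = (\<Sum>h\<in>{- int M..int M}. if int n dvd h - k then osc_integral h f else 0)"
      by (intro sum.cong refl) (simp add: average_fourier_mode[OF n])
    also have "\<dots> = (\<Sum>h\<in>{h \<in> {- int M..int M}. int n dvd h - k}. osc_integral h f)"
      by (rule sum.inter_filter[symmetric]) simp
    finally show ?thesis .
  qed
  ultimately show ?thesis by (simp add: modulated_rectangle_rule_def)
qed

text \<open>
  Cauchy--Schwarz with the weights \<open>(2 \<pi> |h|)\<^sup>s\<close> separates the unit ball of the Sobolev space from the
    arithmetic of the residue class. The frequency 0, whose weight vanishes, cannot occur because
    \<open>n \<ge> 2 |k|\<close> makes \<open>k\<close> an element of least modulus in its class.
\<close>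

lemma aliasing_error_finite:
  assumes f: "f \<in> periodic_sobolev s" "sobolev_norm s f \<le> 1" and s: "s \<ge> 1" and n: "n \<ge> 1"
    and k: "2 * \<bar>k\<bar> \<le> int n"
    and H: "finite H" "k \<notin> H" "\<And>h. h \<in> H \<Longrightarrow> int n dvd h - k"
  shows "norm (\<Sum>h\<in>H. osc_integral h f) \<le> sqrt 2 * (3 / (2 * pi * (real n + \<bar>real_of_int k\<bar>))) ^ s"
proof -
  define N where "N = real n + \<bar>real_of_int k\<bar>"
  define \<beta> where "\<beta> h = (2 * pi * \<bar>real_of_int h\<bar>) ^ s" for h
  have "0 \<notin> H"
  proof
    assume "0 \<in> H"
    then have "k \<noteq> 0" "int n dvd k" using H(2) H(3)[of 0] by auto
    then have "int n \<le> \<bar>k\<bar>" using dvd_imp_le_int[of k "int n"] by simp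
    then show False using k n by linarith
  qed
  then have \<beta>: "\<beta> h > 0" if "h \<in> H" for h
  proof -
    have "h \<noteq> 0" using that \<open>0 \<notin> H\<close> by metis
    then show ?thesis by (simp add: \<beta>_def)
  qed
  define F where "F = (\<lambda>h. (h - k) div int n) ` H"
  have hF: "k + (h - k) div int n * int n = h" if "h \<in> H" for h
    using H(3)[OF that] by simp
  have inj: "inj_on (\<lambda>h. (h - k) div int n) H"
  proof (rule inj_onI)
    fix h h' assume h: "h \<in> H" "h' \<in> H" and eq: "(h - k) div int n = (h' - k) div int n"
    show "h = h'" using hF[OF h(1)] hF[OF h(2)] unfolding eq by simp
  qed
  have "0 \<notin> F"
  proof
    assume "0 \<in> F"
    then obtain h where h: "h \<in> H" and "(h - k) div int n = 0" by (auto simp: F_def)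
    with hF[OF h] have "h = k" by simp
    with h H(2) show False by simp
  qed
  have "(\<Sum>h\<in>H. (1 / \<beta> h)\<^sup>2) = (1 / (2 * pi) ^ s)\<^sup>2 * (\<Sum>h\<in>H. (1 / \<bar>real_of_int h\<bar> ^ s)\<^sup>2)"
    by (simp add: \<beta>_def power_mult_distrib power_divide sum_distrib_left)
  also have "(\<Sum>h\<in>H. (1 / \<bar>real_of_int h\<bar> ^ s)\<^sup>2) = (\<Sum>m\<in>F. (1 / \<bar>real_of_int (k + m * int n)\<bar> ^ s)\<^sup>2)"
    unfolding F_def sum.reindex[OF inj] o_def by (intro sum.cong refl) (simp only: hF)
  also have "(1 / (2 * pi) ^ s)\<^sup>2 * \<dots> \<le> (1 / (2 * pi) ^ s)\<^sup>2 * (2 * ((3 / N) ^ s)\<^sup>2)"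
    unfolding N_def using H(1) \<open>0 \<notin> F\<close>
    by (intro mult_left_mono sum_residue_class_le k n s) (auto simp: F_def)
  also have "\<dots> = 2 * ((3 / (2 * pi * N)) ^ s)\<^sup>2"
    by (simp add: power_divide power_mult_distrib)
  finally have S: "(\<Sum>h\<in>H. (1 / \<beta> h)\<^sup>2) \<le> 2 * ((3 / (2 * pi * N)) ^ s)\<^sup>2" .
  have "norm (\<Sum>h\<in>H. osc_integral h f) \<le> (\<Sum>h\<in>H. norm (osc_integral h f))"
    by (rule norm_sum)
  also have "\<dots> = (\<Sum>h\<in>H. (1 / \<beta> h) * (\<beta> h * norm (osc_integral h f)))"
    using \<beta> by (intro sum.cong) (auto simp: less_imp_neq[symmetric])
  finally have "(norm (\<Sum>h\<in>H. osc_integral h f))\<^sup>2 \<le> (\<Sum>h\<in>H. (1 / \<beta> h) * (\<beta> h * norm (osc_integral h f)))\<^sup>2"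
    by (intro power_mono) auto
  also have "\<dots> \<le> (\<Sum>h\<in>H. (1 / \<beta> h)\<^sup>2) * (\<Sum>h\<in>H. (\<beta> h * norm (osc_integral h f))\<^sup>2)"
    by (rule Cauchy_Schwarz_ineq_sum)
  also have "\<dots> \<le> (2 * ((3 / (2 * pi * N)) ^ s)\<^sup>2) * 1"
    using S Fourier_coefficients_sobolev_bound[OF f H(1)]
    by (intro mult_mono) (auto simp: \<beta>_def sum_nonneg)
  also have "\<dots> = (sqrt 2 * (3 / (2 * pi * N)) ^ s)\<^sup>2"
    by (simp add: power_mult_distrib)
  finally show ?thesis unfolding N_def
    by (rule power2_le_imp_le) (auto intro!: mult_nonneg_nonneg zero_le_power divide_nonneg_nonneg)
qed

text \<open>
  The coefficient at \<open>k\<close> itself is the integral to be computed, so the error is the sum over the rest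
    of the residue class.
\<close>

lemma minimal_error_upper_bound:
  assumes s: "s \<ge> 1" and n: "n \<ge> 1" and k: "2 * \<bar>k\<bar> \<le> int n"
  shows "minimal_error n k s \<le> ennreal (sqrt 2 * (3 / (2 * pi * (real n + \<bar>real_of_int k\<bar>))) ^ s)"
    (is "_ \<le> ennreal ?E")
proof -
  have "norm (osc_integral k f - modulated_rectangle_rule k n f) \<le> ?E"
    if f: "f \<in> periodic_sobolev s" "sobolev_norm s f \<le> 1" for f
  proof -
    define H where "H M = {h \<in> {- int M..int M}. int n dvd h - k}" for M
    have "(\<lambda>M. norm (osc_integral k f - (\<Sum>h\<in>H M. osc_integral h f)))
      \<longlonglongrightarrow> norm (osc_integral k f - modulated_rectangle_rule k n f)"
      unfolding H_def
      by (intro tendsto_norm tendsto_diff tendsto_const modulated_rectangle_rule_aliasing[OF f(1) s n])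
    moreover have "norm (osc_integral k f - (\<Sum>h\<in>H M. osc_integral h f)) \<le> ?E" if "M \<ge> nat \<bar>k\<bar>" for M
    proof -
      have fin: "finite (H M)"
        unfolding H_def by (rule finite_subset[of _ "{- int M..int M}"]) auto
      moreover have "k \<in> H M" using that by (auto simp: H_def)
      ultimately have "(\<Sum>h\<in>H M. osc_integral h f) = osc_integral k f + (\<Sum>h\<in>H M - {k}. osc_integral h f)"
        by (simp add: sum.remove)
      moreover have "norm (\<Sum>h\<in>H M - {k}. osc_integral h f) \<le> ?E"
        by (rule aliasing_error_finite[OF f s n k]) (use fin in \<open>auto simp: H_def\<close>)
      ultimately show ?thesis by simp
    qed
    ultimately show ?thesis by (intro LIMSEQ_le_const2) blast+
  qed
  then have "worst_case_error k s (modulated_rectangle_rule k n) \<le> ennreal ?E"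
    unfolding worst_case_error_def by (intro SUP_least ennreal_leI) auto
  moreover have "minimal_error n k s \<le> worst_case_error k s (modulated_rectangle_rule k n)"
    unfolding minimal_error_def by (intro INF_lower modulated_rectangle_rule_in_algorithms s)
  ultimately show ?thesis by (rule order_trans[rotated])
qed

section \<open>The initial error\<close>

lemma algorithms_0: "algorithms s 0 = {\<lambda>f. 0}"
  by (auto simp: algorithms_def)

lemma initial_error_upper_bound:
  assumes "k \<noteq> 0"
  shows "minimal_error 0 k s \<le> ennreal (1 / (2 * pi * \<bar>real_of_int k\<bar>) ^ s)"
proof -
  have "norm (osc_integral k f) \<le> 1 / (2 * pi * \<bar>real_of_int k\<bar>) ^ s"
    if f: "f \<in> periodic_sobolev s" "sobolev_norm s f \<le> 1" for f
  proof -
    have "((2 * pi * \<bar>real_of_int k\<bar>) ^ s * norm (osc_integral k f))\<^sup>2 \<le> 1\<^sup>2"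
      using Fourier_coefficients_sobolev_bound[OF f, of "{k}"] by simp
    then have "(2 * pi * \<bar>real_of_int k\<bar>) ^ s * norm (osc_integral k f) \<le> 1"
      by (rule power2_le_imp_le) simp
    then show ?thesis using assms by (simp add: field_simps)
  qed
  then show ?thesis
    by (auto simp: minimal_error_def algorithms_0 worst_case_error_def intro!: SUP_least ennreal_leI)
qed

text \<open>
  The equality is confined to the unit interval: at other points a derivative within it is
    unspecified.
\<close>

lemma nth_deriv_fourier_mode:
  assumes "x \<in> {0..1}"
  shows "nth_deriv l (\<lambda>x. c * fourier_mode k x) x = c * (2 * of_real pi * \<i> * of_int k) ^ l * fourier_mode k x"
  using assms
proof (induction l arbitrary: x)
  case 0
  then show ?case by simp
next
  case (Suc l)
  have "((\<lambda>x. c * (2 * of_real pi * \<i> * of_int k) ^ l * fourier_mode k x) has_vector_derivative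
      c * (2 * of_real pi * \<i> * of_int k) ^ l * (2 * of_real pi * \<i> * of_int k * fourier_mode k x)) (at x within {0..1})"
    by (intro has_vector_derivative_mult_right fourier_mode_has_vector_derivative)
  then have "(nth_deriv l (\<lambda>x. c * fourier_mode k x) has_vector_derivative
      c * (2 * of_real pi * \<i> * of_int k) ^ l * (2 * of_real pi * \<i> * of_int k * fourier_mode k x)) (at x within {0..1})"
    by (rule has_vector_derivative_transform[OF Suc.prems Suc.IH, rotated])
  from vector_derivative_within_closed_interval[OF _ Suc.prems this] show ?case
    by (simp add: mult_ac)
qed

lemma fourier_mode_in_periodic_sobolev:
  assumes s: "s \<ge> 1"
  shows "(\<lambda>x. c * fourier_mode k x) \<in> periodic_sobolev s"
proof -
  let ?f = "\<lambda>x. c * fourier_mode k x"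
  let ?d = "\<lambda>l x. c * (2 * of_real pi * \<i> * of_int k) ^ l * fourier_mode k x"
  have der: "(nth_deriv l ?f has_vector_derivative nth_deriv (Suc l) ?f x) (at x within {0..1})"
    if x: "x \<in> {0..1}" for l x
  proof -
    have "(?d l has_vector_derivative
      c * (2 * of_real pi * \<i> * of_int k) ^ l * (2 * of_real pi * \<i> * of_int k * fourier_mode k x)) (at x within {0..1})"
      by (intro has_vector_derivative_mult_right fourier_mode_has_vector_derivative)
    also have "c * (2 * of_real pi * \<i> * of_int k) ^ l * (2 * of_real pi * \<i> * of_int k * fourier_mode k x)
       = nth_deriv (Suc l) ?f x"
      unfolding nth_deriv_fourier_mode[OF x] by (simp add: mult_ac)
    finally show ?thesis
      by (rule has_vector_derivative_transform[OF x nth_deriv_fourier_mode, rotated])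
  qed
  have cont: "continuous_on {0..1} (nth_deriv l ?f)" for l
    unfolding continuous_on_eq_continuous_within
    by (intro ballI has_vector_derivative_continuous[OF der])
  have diff: "nth_deriv l ?f differentiable (at x within {0..1})" if "x \<in> {0..1}" for l x
    using der[OF that, of l] by (auto simp: differentiable_def has_vector_derivative_def)
  have "?f \<in> sobolev s"
    unfolding sobolev_def mem_Collect_eq
  proof (intro conjI allI impI ballI)
    show "absolutely_continuous_fun_on {0..1} (nth_deriv (s - 1) ?f)"
      by (rule continuously_differentiable_imp_absolutely_continuous[OF der cont])
    show "AE x in unit_leb. nth_deriv (s - 1) ?f differentiable (at x within {0..1})"
      by (intro AE_I2) (use diff in auto)
    show "square_integrable_on_unit (nth_deriv s ?f)"
      by (rule continuous_imp_square_integrable[OF cont])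
  qed (rule diff)
  then show ?thesis
    unfolding periodic_sobolev_def by (simp add: nth_deriv_fourier_mode)
qed

lemma sobolev_norm_fourier_mode:
  assumes s: "s \<ge> 1"
  shows "sobolev_norm s (\<lambda>x. c * fourier_mode k x) = norm c * (if k = 0 then 1 else (2 * pi * \<bar>real_of_int k\<bar>) ^ s)"
proof -
  let ?f = "\<lambda>x. c * fourier_mode k x"
  let ?w = "2 * of_real pi * \<i> * of_int k :: complex"
  have "(\<integral>x. nth_deriv l ?f x \<partial>unit_leb) = (\<integral>x. c * ?w ^ l * fourier_mode k x \<partial>unit_leb)" for l
    by (intro Bochner_Integration.integral_cong refl nth_deriv_fourier_mode) simp
  then have "(\<integral>x. nth_deriv l ?f x \<partial>unit_leb) = (if k = 0 \<and> l = 0 then c else 0)" for l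
    by (simp add: integral_fourier_mode)
  moreover have "(\<integral>x. (norm (nth_deriv s ?f x))\<^sup>2 \<partial>unit_leb) = (\<integral>x. (norm c * norm ?w ^ s)\<^sup>2 \<partial>unit_leb)"
    by (intro Bochner_Integration.integral_cong refl) (simp add: nth_deriv_fourier_mode norm_mult norm_power del: nth_deriv.simps)
  moreover have "norm ?w = 2 * pi * \<bar>real_of_int k\<bar>" by (simp add: norm_mult)
  moreover have "(\<Sum>l<s. (norm (if k = 0 \<and> l = 0 then c else 0))\<^sup>2) = (if k = 0 then (norm c)\<^sup>2 else 0)"
  proof -
    have "(\<Sum>l<s. (norm (if k = 0 \<and> l = 0 then c else 0))\<^sup>2) = (\<Sum>l<s. if l = 0 then (if k = 0 then (norm c)\<^sup>2 else 0) else 0)"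
      by (intro sum.cong) auto
    also have "\<dots> = (if k = 0 then (norm c)\<^sup>2 else 0)" using s by (simp add: sum.delta)
    finally show ?thesis .
  qed
  ultimately show ?thesis
    unfolding sobolev_norm_eq using s by (auto simp: real_sqrt_mult power_0_left)
qed

text \<open>
  The extremal function is the multiple of the \<open>k\<close>-th exponential that has norm one. For \<open>k = 0\<close> this is
    the constant 1, whose norm comes from the mean value and not from the derivative of order \<open>s\<close>.
\<close>

lemma initial_error_lower_bound:
  assumes s: "s \<ge> 1"
  shows "ennreal (if k = 0 then 1 else 1 / (2 * pi * \<bar>real_of_int k\<bar>) ^ s) \<le> minimal_error 0 k s"
proof -
  define c where "c = (if k = 0 then 1 else 1 / (2 * pi * \<bar>real_of_int k\<bar>) ^ s)"
  have c: "c > 0" by (auto simp: c_def)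
  define f where "f = (\<lambda>x. of_real c * fourier_mode k x)"
  have "f \<in> periodic_sobolev s"
    unfolding f_def by (rule fourier_mode_in_periodic_sobolev[OF s])
  moreover have "sobolev_norm s f \<le> 1"
    unfolding f_def sobolev_norm_fourier_mode[OF s] by (auto simp: c_def abs_of_nonneg)
  moreover have "norm (osc_integral k f) = c"
    using c by (simp add: f_def osc_integral_cmult osc_integral_fourier_mode)
  ultimately have "ennreal c \<le> worst_case_error k s (\<lambda>_. 0)"
    unfolding worst_case_error_def by (intro SUP_upper2[of f]) auto
  then show ?thesis by (simp add: minimal_error_def algorithms_0 c_def)
qed

section \<open>Information complexity\<close>

lemma powr_bound_imp_error_le:
  assumes s: "s \<ge> 1" and \<epsilon>: "\<epsilon> > 0"
    and N: "N > 0" "3 / (2 * pi) * (sqrt 2 / \<epsilon>) powr (1 / real s) \<le> N"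
  shows "sqrt 2 * (3 / (2 * pi * N)) ^ s \<le> \<epsilon>"
proof -
  define P where "P = (sqrt 2 / \<epsilon>) powr (1 / real s)"
  have P: "P > 0" using \<epsilon> by (simp add: P_def)
  have "P ^ s = P powr real s" using P by (simp add: powr_realpow)
  also have "\<dots> = sqrt 2 / \<epsilon>" using s \<epsilon> by (simp add: P_def powr_powr)
  finally have Ps: "P ^ s = sqrt 2 / \<epsilon>" .
  have "3 / (2 * pi * N) \<le> 1 / P"
    using N P by (simp add: P_def[symmetric] field_simps)
  then have "(3 / (2 * pi * N)) ^ s \<le> (1 / P) ^ s"
    using N by (intro power_mono) auto
  also have "\<dots> = \<epsilon> / sqrt 2" by (simp add: power_divide Ps)
  finally show ?thesis by (simp add: field_simps)
qed

text \<open>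
  The assumption places the ceiling \<open>N\<close> strictly above \<open>3 |k|\<close>. Hence \<open>n = N - |k|\<close> is positive and at least
    \<open>2 |k|\<close>, as the error bound for the rectangle rule requires, and \<open>n + |k|\<close> is exactly \<open>N\<close>. That the minimum
    defining the complexity is attained is recorded for the lower bound.
\<close>

lemma info_complexity_abs_upper_bound:
  assumes s: "s \<ge> 1" and \<epsilon>: "\<epsilon> > 0"
    and X: "3 * \<bar>real_of_int k\<bar> < 3 / (2 * pi) * (sqrt 2 / \<epsilon>) powr (1 / real s)"
  shows "minimal_error (info_complexity_abs \<epsilon> k s) k s \<le> ennreal \<epsilon>"
    and "int (info_complexity_abs \<epsilon> k s) \<le> \<lceil>3 / (2 * pi) * (sqrt 2 / \<epsilon>) powr (1 / real s)\<rceil> - \<bar>k\<bar>"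
proof -
  let ?X = "3 / (2 * pi) * (sqrt 2 / \<epsilon>) powr (1 / real s)"
  define n where "n = nat (\<lceil>?X\<rceil> - \<bar>k\<bar>)"
  have "real_of_int (3 * \<bar>k\<bar>) < ?X" using X by simp
  then have ceil: "3 * \<bar>k\<bar> < \<lceil>?X\<rceil>" by (simp only: less_ceiling_iff)
  then have n: "n \<ge> 1" "2 * \<bar>k\<bar> \<le> int n" "int n = \<lceil>?X\<rceil> - \<bar>k\<bar>" by (auto simp: n_def)
  then have "real_of_int (int n + \<bar>k\<bar>) = real_of_int \<lceil>?X\<rceil>" by simp
  then have N: "?X \<le> real n + \<bar>real_of_int k\<bar>" by simp
  have "minimal_error n k s \<le> ennreal (sqrt 2 * (3 / (2 * pi * (real n + \<bar>real_of_int k\<bar>))) ^ s)"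
    by (rule minimal_error_upper_bound[OF s n(1,2)])
  also have "\<dots> \<le> ennreal \<epsilon>"
    using n(1) by (intro ennreal_leI powr_bound_imp_error_le[OF s \<epsilon> _ N]) auto
  finally have *: "minimal_error n k s \<le> ennreal \<epsilon>" .
  then show "minimal_error (info_complexity_abs \<epsilon> k s) k s \<le> ennreal \<epsilon>"
    unfolding info_complexity_abs_def by (rule LeastI)
  have "info_complexity_abs \<epsilon> k s \<le> n"
    unfolding info_complexity_abs_def using * by (rule Least_le)
  then show "int (info_complexity_abs \<epsilon> k s) \<le> \<lceil>?X\<rceil> - \<bar>k\<bar>" using n(3) by simp
qed

text \<open>
  The lower error estimate is given for positive \<open>n\<close> only. The complexity is positive because \<open>\<epsilon>\<close> is smaller
    than the initial error.
\<close>

lemma info_complexity_abs_lower_bound: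
  assumes s: "s \<ge> 1" and \<epsilon>: "\<epsilon> > 0" and c_pos: "c > 0"
    and c_lower: "\<And>n. n \<ge> 1 \<Longrightarrow> ennreal (c / (real n + \<bar>real_of_int k\<bar>) ^ s) \<le> minimal_error n k s"
    and attained: "minimal_error (info_complexity_abs \<epsilon> k s) k s \<le> ennreal \<epsilon>"
    and initial: "\<epsilon> < (if k = 0 then 1 else 1 / (2 * pi * \<bar>real_of_int k\<bar>) ^ s)"
  shows "c powr (1 / real s) * (1 / \<epsilon>) powr (1 / real s) - \<bar>real_of_int k\<bar> \<le> real (info_complexity_abs \<epsilon> k s)"
proof -
  define n where "n = info_complexity_abs \<epsilon> k s"
  define N where "N = real n + \<bar>real_of_int k\<bar>"
  have "n \<noteq> 0"
  proof
    assume "n = 0"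
    then have "ennreal (if k = 0 then 1 else 1 / (2 * pi * \<bar>real_of_int k\<bar>) ^ s) \<le> ennreal \<epsilon>"
      using initial_error_lower_bound[OF s, of k] attained unfolding n_def by (metis order_trans)
    then show False using initial \<epsilon> by (simp add: ennreal_le_iff)
  qed
  then have N: "N > 0" by (simp add: N_def)
  have "ennreal (c / N ^ s) \<le> ennreal \<epsilon>"
    using c_lower[of n] \<open>n \<noteq> 0\<close> attained unfolding n_def N_def by (metis One_nat_def Suc_leI neq0_conv order_trans)
  then have "c / N ^ s \<le> \<epsilon>" using \<epsilon> by (simp add: ennreal_le_iff)
  then have "c / \<epsilon> \<le> N ^ s" using N \<epsilon> by (simp add: field_simps)
  have "c powr (1 / real s) * (1 / \<epsilon>) powr (1 / real s) = (c / \<epsilon>) powr (1 / real s)"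
    using c_pos \<epsilon> by (simp add: powr_mult[symmetric])
  also have "\<dots> \<le> (N ^ s) powr (1 / real s)"
    using \<open>c / \<epsilon> \<le> N ^ s\<close> c_pos \<epsilon> by (intro powr_mono2) auto
  also have "\<dots> = N"
    using N s by (simp add: powr_realpow[symmetric] powr_powr)
  finally show ?thesis by (simp add: N_def n_def)
qed

theorem corollary10:
  fixes s :: nat and c :: real
  assumes s: "s \<ge> 1"
    and c_pos: "c > 0"
    and c_lower: "\<And>(k :: int) (n :: nat). n \<ge> 1 \<Longrightarrow>
      ennreal (c / (real n + \<bar>real_of_int k\<bar>) ^ s) \<le> minimal_error n k s"
  shows
    "(\<forall>\<epsilon>::real. 0 < \<epsilon> \<and> \<epsilon> < 1 \<longrightarrow>
        c powr (1 / real s) * (1 / \<epsilon>) powr (1 / real s) \<le> real (info_complexity_abs \<epsilon> 0 s) \<and>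
        int (info_complexity_abs \<epsilon> 0 s) \<le> \<lceil>3 / (2 * pi) * (sqrt 2 / \<epsilon>) powr (1 / real s)\<rceil>) \<and>
     (\<forall>k::int. k \<noteq> 0 \<longrightarrow>
        (\<forall>\<epsilon>::real. 1 / (2 * pi * \<bar>real_of_int k\<bar>) ^ s \<le> \<epsilon> \<and> \<epsilon> < 1 \<longrightarrow>
           info_complexity_abs \<epsilon> k s = 0) \<and>
        (\<forall>\<epsilon>::real. 0 < \<epsilon> \<and> \<epsilon> < 1 / (2 * pi * \<bar>real_of_int k\<bar>) ^ s \<longrightarrow>
           c powr (1 / real s) * (1 / \<epsilon>) powr (1 / real s) - \<bar>real_of_int k\<bar>
             \<le> real (info_complexity_abs \<epsilon> k s) \<and>
           int (info_complexity_abs \<epsilon> k s)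
             \<le> \<lceil>3 / (2 * pi) * (sqrt 2 / \<epsilon>) powr (1 / real s)\<rceil> - \<bar>k\<bar>))"
proof (intro conjI allI impI; (elim conjE)?)
  fix \<epsilon> :: real assume \<epsilon>: "0 < \<epsilon>" "\<epsilon> < 1"
  have X: "3 * \<bar>real_of_int 0\<bar> < 3 / (2 * pi) * (sqrt 2 / \<epsilon>) powr (1 / real s)"
    using \<epsilon> by simp
  note upper = info_complexity_abs_upper_bound[OF s \<epsilon>(1) X]
  show "int (info_complexity_abs \<epsilon> 0 s) \<le> \<lceil>3 / (2 * pi) * (sqrt 2 / \<epsilon>) powr (1 / real s)\<rceil>"
    using upper(2) by simp
  show "c powr (1 / real s) * (1 / \<epsilon>) powr (1 / real s) \<le> real (info_complexity_abs \<epsilon> 0 s)"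
    using info_complexity_abs_lower_bound[OF s \<epsilon>(1) c_pos c_lower upper(1)] \<epsilon>(2) by simp
next
  fix k :: int and \<epsilon> :: real
  assume k: "k \<noteq> 0" and \<epsilon>: "1 / (2 * pi * \<bar>real_of_int k\<bar>) ^ s \<le> \<epsilon>"
  have "minimal_error 0 k s \<le> ennreal \<epsilon>"
    using initial_error_upper_bound[OF k, of s] ennreal_leI[OF \<epsilon>] by (rule order_trans)
  then show "info_complexity_abs \<epsilon> k s = 0"
    unfolding info_complexity_abs_def by (rule Least_eq_0)
next
  fix k :: int and \<epsilon> :: real
  assume k: "k \<noteq> 0" and \<epsilon>: "0 < \<epsilon>" "\<epsilon> < 1 / (2 * pi * \<bar>real_of_int k\<bar>) ^ s"
  define Q where "Q = 2 * pi * \<bar>real_of_int k\<bar>"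
  have Q: "Q > 0" using k by (simp add: Q_def)
  \<comment> \<open>Here \<open>\<epsilon>\<close> lies below the initial error \<open>1 / Q\<^sup>s\<close>, which gives the size condition on the ceiling.\<close>
  have "\<epsilon> * Q ^ s < 1"
    using \<epsilon>(2) Q by (simp only: Q_def[symmetric] pos_less_divide_eq zero_less_power)
  then have "Q ^ s < 1 / \<epsilon>" using \<epsilon>(1) by (simp add: pos_less_divide_eq mult.commute)
  also have "1 / \<epsilon> \<le> sqrt 2 / \<epsilon>" using \<epsilon> by (simp add: divide_right_mono)
  finally have "(Q ^ s) powr (1 / real s) < (sqrt 2 / \<epsilon>) powr (1 / real s)"
    using Q s by (intro powr_less_mono2) auto
  moreover have "(Q ^ s) powr (1 / real s) = Q"
    using Q s by (simp add: powr_realpow[symmetric] powr_powr)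
  ultimately have X: "3 * \<bar>real_of_int k\<bar> < 3 / (2 * pi) * (sqrt 2 / \<epsilon>) powr (1 / real s)"
    by (simp add: Q_def field_simps)
  note upper = info_complexity_abs_upper_bound[OF s \<epsilon>(1) X]
  show "int (info_complexity_abs \<epsilon> k s) \<le> \<lceil>3 / (2 * pi) * (sqrt 2 / \<epsilon>) powr (1 / real s)\<rceil> - \<bar>k\<bar>"
    by (rule upper(2))
  show "c powr (1 / real s) * (1 / \<epsilon>) powr (1 / real s) - \<bar>real_of_int k\<bar> \<le> real (info_complexity_abs \<epsilon> k s)"
    using info_complexity_abs_lower_bound[OF s \<epsilon>(1) c_pos c_lower upper(1)] \<epsilon>(2) k by simp
qed

end
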